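(* Let $n,k\in\mathbb{N}$, $n\ge k$, and let $\varphi:(\mathbb{R}^n)^k\to\mathbb{R}$ be orthogonally symmetric, i.e. for any $O\in O(n)$, $\varphi(Ox_1,\ldots,Ox_k)=\varphi(x_1,\ldots,x_k)$. Then $$\int_{(\mathbb{R}^n)^k}\varphi(x_1,\ldots,x_k)\,dx_1\cdots dx_k=\int_{(\mathbb{R}^k)^k}\varphi(x_1,\ldots,x_k)\,C_{n,k}\,\bigl|\det[x_1,\ldots,x_k]\bigr|^{n-k}\,dx_1\cdots dx_k,$$ where in $\varphi(x_1,\ldots,x_k)$ on the right-hand side, $x_1,\ldots,x_k\in\mathbb{R}^k$ are considered as vectors in $\mathbb{R}^n$ via the natural embedding of $\mathbb{R}^k$ in $\mathbb{R}^n$, $[x_1,\ldots,x_k]$ is the $k\times k$ matrix whose columns are $x_1,\ldots,x_k$, and $C_{n,k}$ is a constant.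
   Context: $O(n)$ is the group of real orthogonal $n\times n$ matrices. The natural embedding of $\mathbb{R}^k$ in $\mathbb{R}^n$ appends $n-k$ zero coordinates. Integrals are with respect to Lebesgue measure. The subscripts of $C_{n,k}$ indicate its dependence on $n$ and $k$. *)

theory Defs
  imports "HOL-Analysis.Analysis"
begin

text \<open>
  A \<open>k\<close>-tuple \<open>(x\<^sub>1, \<dots>, x\<^sub>k)\<close> of vectors in \<open>n\<close>-space is an \<open>x :: ('n, 'k) vec_tuple\<close>, with \<open>x $ j\<close>
  the \<open>j\<close>-th vector. The measure \<^const>\<open>lebesgue\<close> on this type is Lebesgue measure on
  \<open>nk\<close>-dimensional space, that is, \<open>dx\<^sub>1 \<dots> dx\<^sub>k\<close>.
\<close>

type_synonym ('n, 'k) vec_tuple = "real ^ 'n ^ 'k"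

definition orthogonally_symmetric :: "(('n :: finite, 'k :: finite) vec_tuple \<Rightarrow> real) \<Rightarrow> bool" where
  "orthogonally_symmetric \<phi> \<longleftrightarrow>
     (\<forall>Q :: real ^ 'n ^ 'n. orthogonal_matrix Q \<longrightarrow> (\<forall>x. \<phi> (\<chi> j. Q *v (x $ j)) = \<phi> x))"

text \<open>
  ``Appending zero coordinates'' needs an order on the coordinates, so the index types are finite
  linear orders, and coordinates are numbered from 0 along this order.
\<close>

definition coord_index :: "'i :: {finite, linorder} \<Rightarrow> nat" where
  "coord_index i = card {..<i}"

lemma bij_betw_coord_index:
  "bij_betw coord_index (UNIV :: 'i :: {finite, linorder} set) {..<CARD('i)}"
proof -
  have "strict_mono (coord_index :: 'i \<Rightarrow> nat)"
    unfolding strict_mono_def coord_index_def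
    by (auto intro!: psubset_card_mono)
  then have inj: "inj (coord_index :: 'i \<Rightarrow> nat)"
    by (rule strict_mono_imp_inj_on)
  have "range (coord_index :: 'i \<Rightarrow> nat) \<subseteq> {..<CARD('i)}"
    unfolding coord_index_def by (auto intro!: psubset_card_mono)
  moreover have "card (range (coord_index :: 'i \<Rightarrow> nat)) = card {..<CARD('i)}"
    using card_image[OF inj] by simp
  ultimately show ?thesis
    unfolding bij_betw_def using inj by (simp add: card_subset_eq)
qed

definition natural_embedding ::
    "real ^ 'k :: {finite, linorder} \<Rightarrow> real ^ 'n :: {finite, linorder}" where
  "natural_embedding y =
     (\<chi> i. if coord_index i < CARD('k) then y $ inv coord_index (coord_index i) else 0)"

text \<open>The matrix \<open>[x\<^sub>1, \<dots>, x\<^sub>k]\<close> whose columns are the given vectors (\<open>A $ i $ j\<close> is the entry in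
  row \<open>i\<close> and column \<open>j\<close>).\<close>

definition column_matrix :: "('n :: finite, 'k :: finite) vec_tuple \<Rightarrow> real ^ 'k ^ 'n" where
  "column_matrix x = (\<chi> i j. x $ j $ i)"

end

theory Submission
  imports Defs
begin

text \<open>
  A tuple is regarded as a matrix with \<open>k\<close> rows in \<open>n\<close>-space. Square matrices \<open>M\<close> of size \<open>k\<close> act on tuples
  from the left, orthogonal matrices of size \<open>n\<close> act on the right, and the two actions commute. Almost every
  tuple is a rotation of an embedded invertible square matrix
  (\<open>exists_rotated_embedding\<close>, \<open>AE_gram_nonsingular\<close>), so an orthogonally symmetric function is
  determined by its values on embedded square matrices. Up to a null set, the space of orbits is thus a
  homogeneous space of the general linear group, and the theorem says that two measures on it are
  proportional: the image of Lebesgue measure on tuples and the image of the measure with density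
  \<open>|det y|^(n-k)\<close> on square matrices. Both are multiplied by the same power \<open>|det M|^n\<close> under the action
  of \<open>M\<close> (\<open>scales_lborel_matrix_mult_left\<close>), and such a measure is unique up to a factor.

  Uniqueness is proved by hand, with Fubini's theorem. For an invariant function \<open>F\<close> and a suitable invariant
  test function \<open>h\<close>, the integral of \<open>h(z) F(M z) |det M|^(n-k)\<close> over all tuples \<open>z\<close> and square
  matrices \<open>M\<close> is evaluated in both orders. One order gives a constant times the integral of \<open>F\<close> over
  embedded square matrices, the other a constant times the integral of \<open>F\<close> over all tuples
  (\<open>nn_integral_invariant_proportional\<close>).

  The double integral handles nonnegative Borel functions. The theorem speaks of arbitrary symmetric functions
  and Lebesgue measurability, and the embedded square matrices form a null set if \<open>k < n\<close>, so it must also be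
  shown that an invariant set is Lebesgue measurable if and only if its trace on square matrices is. Since
  the orthogonal group is compact, rotating a countable union of compact sets gives such a union again.
  Hence invariant sets, if measurable in either space, lie between invariant Borel sets that differ by a null set
  (\<open>invariant_sandwich\<close>).
\<close>

section \<open>Lebesgue measure under linear bijections\<close>

text \<open>
  The number \<open>c\<close> is the reciprocal of the modulus of \<open>T\<close>: preimages under \<open>T\<close> have \<open>c\<close> times the
  measure of the original set. The condition is phrased for integrals because that is the form in
  which the substitutions below use it.
\<close>

definition scales_lborel :: "('a::euclidean_space \<Rightarrow> 'a) \<Rightarrow> real \<Rightarrow> bool" where
  "scales_lborel T c \<longleftrightarrow> c > 0 \<and> T \<in> borel_measurable borel \<and>
    (\<forall>f :: 'a \<Rightarrow> ennreal. f \<in> borel_measurable borel \<longrightarrow>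
      (\<integral>\<^sup>+x. f (T x) \<partial>lborel) = ennreal c * (\<integral>\<^sup>+x. f x \<partial>lborel))"

lemma nn_integral_lborel_shift:
  fixes f :: "'a::euclidean_space \<Rightarrow> ennreal"
  assumes [measurable]: "f \<in> borel_measurable borel"
  shows "(\<integral>\<^sup>+x. f (a + x) \<partial>lborel) = (\<integral>\<^sup>+x. f x \<partial>lborel)"
proof -
  have "(\<integral>\<^sup>+x. f x \<partial>lborel) = (\<integral>\<^sup>+x. f x \<partial>(distr lborel borel ((+) a)))"
    by (simp add: lborel_distr_plus)
  also have "\<dots> = (\<integral>\<^sup>+x. f (a + x) \<partial>lborel)"
    by (rule nn_integral_distr) auto
  finally show ?thesis by simp
qed

lemma nn_integral_lborel_reflect:
  fixes f :: "'a::euclidean_space \<Rightarrow> ennreal"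
  assumes [measurable]: "f \<in> borel_measurable borel"
  shows "(\<integral>\<^sup>+x. f (a - x) \<partial>lborel) = (\<integral>\<^sup>+x. f x \<partial>lborel)"
proof -
  have "(\<integral>\<^sup>+x. f x \<partial>lborel) = (\<integral>\<^sup>+x. f x \<partial>(density (distr lborel borel (\<lambda>x. a + (-1) *\<^sub>R x)) (\<lambda>_. ennreal (\<bar>-1\<bar>^DIM('a)))))"
    by (subst lborel_affine[of "-1" a]) auto
  also have "\<dots> = (\<integral>\<^sup>+x. f x \<partial>distr lborel borel (\<lambda>x. a - x))"
    by (simp add: density_1)
  also have "\<dots> = (\<integral>\<^sup>+x. f (a - x) \<partial>lborel)"
    by (rule nn_integral_distr) auto
  finally show ?thesis by simp
qed

text \<open>
  The functional \<open>f \<mapsto> \<integral> f (T x) dx\<close> is translation invariant, so this is the uniqueness of Haar measure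
  in a special case. As usual, uniqueness comes from Fubini: both sides of the equation \<open>swap\<close> in the
  proof are the integral of \<open>f (T x) g (T x + y)\<close> over all \<open>x\<close> and \<open>y\<close>. Taking for \<open>g\<close> the indicator of
  the unit cube yields the factor.
\<close>

lemma linear_scales_lborel:
  fixes T :: "'a::euclidean_space \<Rightarrow> 'a"
  assumes "linear T" "inj T"
  obtains c where "scales_lborel T c"
proof -
  have T [measurable]: "T \<in> borel_measurable borel"
    by (simp add: assms borel_measurable_continuous_onI linear_continuous_on linear_conv_bounded_linear[symmetric])
  obtain S where S: "linear S" "T \<circ> S = id" "S \<circ> T = id"
    using linear_injective_isomorphism[OF assms] by (auto simp: fun_eq_iff)
  have S_meas [measurable]: "S \<in> borel_measurable borel"
    by (simp add: S borel_measurable_continuous_onI linear_continuous_on linear_conv_bounded_linear[symmetric])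
  have TS: "T (S x) = x" and ST: "S (T x) = x" for x
    using S by (auto simp: fun_eq_iff)
  have swap: "(\<integral>\<^sup>+x. f (T x) \<partial>lborel) * (\<integral>\<^sup>+y. g y \<partial>lborel)
      = (\<integral>\<^sup>+x. g (T x) \<partial>lborel) * (\<integral>\<^sup>+y. f y \<partial>lborel)"
    if [measurable]: "f \<in> borel_measurable borel" "g \<in> borel_measurable borel"
    for f g :: "'a \<Rightarrow> ennreal"
  proof -
    have "(\<integral>\<^sup>+x. f (T x) \<partial>lborel) * (\<integral>\<^sup>+y. g y \<partial>lborel)
        = (\<integral>\<^sup>+x. (\<integral>\<^sup>+y. f (T x) * g (T x + y) \<partial>lborel) \<partial>lborel)"
      by (simp add: nn_integral_cmult nn_integral_multc nn_integral_lborel_shift[of g])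
    also have "\<dots> = (\<integral>\<^sup>+y. (\<integral>\<^sup>+x. f (T x) * g (T x + y) \<partial>lborel) \<partial>lborel)"
      by (rule lborel_pair.Fubini'[symmetric]) measurable
    also have "\<dots> = (\<integral>\<^sup>+y. (\<integral>\<^sup>+x. f (T x - y) * g (T x) \<partial>lborel) \<partial>lborel)"
    proof (rule nn_integral_cong)
      fix y
      show "(\<integral>\<^sup>+x. f (T x) * g (T x + y) \<partial>lborel) = (\<integral>\<^sup>+x. f (T x - y) * g (T x) \<partial>lborel)"
        using nn_integral_lborel_shift[of "\<lambda>x. f (T x) * g (T x + y)" "- S y"]
        by (simp add: linear_diff[OF assms(1)] TS)
    qed
    also have "\<dots> = (\<integral>\<^sup>+x. (\<integral>\<^sup>+y. f (T x - y) * g (T x) \<partial>lborel) \<partial>lborel)"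
      by (rule lborel_pair.Fubini') measurable
    also have "\<dots> = (\<integral>\<^sup>+x. g (T x) \<partial>lborel) * (\<integral>\<^sup>+y. f y \<partial>lborel)"
      by (simp add: nn_integral_cmult nn_integral_multc nn_integral_lborel_reflect[of f] mult.commute)
    finally show ?thesis .
  qed
  define B where "B = box (0::'a) One"
  define c where "c = (\<integral>\<^sup>+x. indicator B (T x) \<partial>lborel)"
  have [measurable]: "B \<in> sets borel" by (simp add: B_def)
  have B: "(\<integral>\<^sup>+y. indicator B y \<partial>lborel) = 1"
    by (simp add: B_def)
  have c: "(\<integral>\<^sup>+x. f (T x) \<partial>lborel) = c * (\<integral>\<^sup>+y. f y \<partial>lborel)"
    if "f \<in> borel_measurable borel" for f :: "'a \<Rightarrow> ennreal"
    using swap[OF that, of "indicator B"] unfolding c_def B by simp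
  \<comment> \<open>The indicator of the image of the cube under \<open>T\<close> shows that the factor is neither \<open>0\<close> nor \<open>\<infinity>\<close>.\<close>
  have "1 = c * (\<integral>\<^sup>+y. indicator B (S y) \<partial>lborel)"
    using c[of "\<lambda>y. indicator B (S y)"] by (simp add: ST B)
  then have "c \<noteq> 0" "c \<noteq> top"
    by (auto simp: ennreal_top_mult split: if_splits)
  then obtain r where "c = ennreal r" "r > 0"
    by (cases c) auto
  then have "scales_lborel T r"
    unfolding scales_lborel_def using c by simp
  then show thesis ..
qed

lemma scales_lborel_unique:
  assumes "scales_lborel T a" "scales_lborel T b"
  shows "a = b"
proof -
  have "(\<integral>\<^sup>+y. indicator (box (0::'a) One) y \<partial>lborel) = 1" by simp
  then show ?thesis
    using assms unfolding scales_lborel_def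
    by (metis (no_types, lifting) borel_measurable_indicator box_borel ennreal_inj less_imp_le mult.right_neutral)
qed

lemma scales_lborel_compose:
  assumes "scales_lborel S a" "scales_lborel T b"
  shows "scales_lborel (\<lambda>x. S (T x)) (a * b)"
proof -
  have [measurable]: "S \<in> borel_measurable borel" "T \<in> borel_measurable borel"
    and ab: "a > 0" "b > 0"
    using assms by (auto simp: scales_lborel_def)
  have "(\<integral>\<^sup>+x. f (S (T x)) \<partial>lborel) = ennreal (a * b) * (\<integral>\<^sup>+x. f x \<partial>lborel)"
    if [measurable]: "f \<in> borel_measurable borel" for f
  proof -
    have "(\<integral>\<^sup>+x. f (S (T x)) \<partial>lborel) = ennreal b * (\<integral>\<^sup>+x. f (S x) \<partial>lborel)"
      using assms(2) unfolding scales_lborel_def by (auto elim!: allE[where x="\<lambda>x. f (S x)"])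
    also have "(\<integral>\<^sup>+x. f (S x) \<partial>lborel) = ennreal a * (\<integral>\<^sup>+x. f x \<partial>lborel)"
      using assms(1) unfolding scales_lborel_def by simp
    finally show ?thesis
      using ab by (simp add: ennreal_mult mult_ac)
  qed
  then show ?thesis
    using ab unfolding scales_lborel_def by simp
qed

lemma scales_lborel_id: "scales_lborel (\<lambda>x. x) 1"
  unfolding scales_lborel_def by simp

text \<open>
  Factors are positive and multiplicative, so the factor of an involution is a positive square root
  of \<open>1\<close>.
\<close>

lemma scales_lborel_involution:
  assumes "linear T" "\<And>x. T (T x) = x"
  shows "scales_lborel T 1"
proof -
  have "inj T" using assms(2) by (metis injI)
  then obtain c where c: "scales_lborel T c"
    using linear_scales_lborel assms(1) by blast
  have "c * c = 1"
    using scales_lborel_compose[OF c c] scales_lborel_id scales_lborel_unique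
    by (simp add: assms(2) cong: if_cong) blast
  moreover have "c > 0" using c by (simp add: scales_lborel_def)
  ultimately have "c = 1"
    by (metis abs_of_pos mult.right_neutral abs_mult_self_eq real_sqrt_abs2 real_sqrt_one)
  then show ?thesis using c by simp
qed

lemma linear_matrix_mult_left: "linear (\<lambda>x :: real^'n^'k. (M :: real^'k^'m) ** x)"
  by (rule linearI) (simp_all add: vec_eq_iff matrix_matrix_mult_def distrib_left sum.distrib
      sum_distrib_left mult_ac)

lemma inj_matrix_mult_left:
  fixes M :: "real^'k^'k"
  assumes "det M \<noteq> 0"
  shows "inj (\<lambda>x :: real^'n^'k. M ** x)"
proof (rule injI)
  fix x y :: "real^'n^'k"
  assume "M ** x = M ** y"
  moreover obtain N where "N ** M = mat 1"
    using assms unfolding invertible_det_nz[symmetric] invertible_def by blast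
  ultimately show "x = y"
    by (metis matrix_mul_assoc matrix_mul_lid)
qed

lemma prod_Basis_matrix:
  fixes g :: "real^'n^'k \<Rightarrow> real"
  shows "(\<Prod>b\<in>Basis. g b) = (\<Prod>i\<in>UNIV. \<Prod>j\<in>UNIV. g (axis i (axis j 1)))"
proof -
  have "(\<Prod>b\<in>Basis. g b) = (\<Prod>(i, j)\<in>UNIV \<times> UNIV. g (axis i (axis j 1)))"
    by (rule prod.reindex_cong[where l="\<lambda>(i, j). axis i (axis j 1)"])
      (auto simp: inj_on_def Basis_vec_def axis_eq_axis image_iff)
  then show ?thesis by (simp add: prod.cartesian_product)
qed

lemma scales_lborel_diagonal:
  fixes D :: "real^'k^'k"
  assumes diag: "\<And>i j. i \<noteq> j \<Longrightarrow> D $ i $ j = 0" and det: "det D \<noteq> 0"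
  shows "scales_lborel (\<lambda>x :: real^'n^'k. D ** x) (1 / \<bar>det D\<bar> ^ CARD('n))"
proof -
  let ?c = "\<lambda>b :: real^'n^'k. (D ** b) \<bullet> b"
  have comp: "(D ** x) $ i $ j = D $ i $ i * x $ i $ j" for x :: "real^'n^'k" and i j
  proof -
    have "(D ** x) $ i $ j = (\<Sum>k\<in>UNIV. if k = i then D $ i $ i * x $ i $ j else 0)"
      unfolding matrix_matrix_mult_def vec_lambda_beta
    proof (rule sum.cong)
      show "D $ i $ k * x $ k $ j = (if k = i then D $ i $ i * x $ i $ j else 0)" for k
        by (cases "k = i") (use diag[of i k] in auto)
    qed simp
    then show ?thesis by simp
  qed
  have cb: "?c (axis i (axis j 1)) = D $ i $ i" for i and j :: 'n
    by (simp add: inner_axis comp)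
  have detD: "det D = (\<Prod>i\<in>UNIV. D $ i $ i)"
    by (rule det_diagonal) (rule diag)
  have nz: "D $ i $ i \<noteq> 0" for i
    using det unfolding detD by auto
  have expand: "D ** x = 0 + (\<Sum>b\<in>Basis. (?c b * (x \<bullet> b)) *\<^sub>R b)" for x :: "real^'n^'k"
  proof (rule euclidean_eqI)
    fix b :: "real^'n^'k" assume b: "b \<in> Basis"
    then obtain i j where "b = axis i (axis j 1)"
      by (auto simp: Basis_vec_def)
    then have "(D ** x) \<bullet> b = ?c b * (x \<bullet> b)"
      by (simp add: cb) (simp add: inner_axis comp)
    then show "(D ** x) \<bullet> b = (0 + (\<Sum>b\<in>Basis. (?c b * (x \<bullet> b)) *\<^sub>R b)) \<bullet> b"
      using b by simp
  qed
  have eq: "(\<lambda>x :: real^'n^'k. D ** x) = (\<lambda>x. 0 + (\<Sum>b\<in>Basis. (?c b * (x \<bullet> b)) *\<^sub>R b))"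
    by (rule ext) (rule expand)
  have pos: "\<bar>det D\<bar> ^ CARD('n) > 0" using det by simp
  have p: "(\<Prod>b\<in>Basis. \<bar>?c b\<bar>) = \<bar>det D\<bar> ^ CARD('n)"
    by (simp add: prod_Basis_matrix cb detD abs_prod prod_power_distrib)
  have "(lborel :: (real^'n^'k) measure)
      = density (distr lborel borel (\<lambda>x. 0 + (\<Sum>b\<in>Basis. (?c b * (x \<bullet> b)) *\<^sub>R b))) (\<lambda>_. ennreal (\<Prod>b\<in>Basis. \<bar>?c b\<bar>))"
    by (rule lborel_affine_euclidean) (auto simp: Basis_vec_def cb nz)
  then have leb: "(lborel :: (real^'n^'k) measure)
      = density (distr lborel borel (\<lambda>x. D ** x)) (\<lambda>_. ennreal (\<bar>det D\<bar> ^ CARD('n)))"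
    unfolding p eq[symmetric] .
  have [measurable]: "(\<lambda>x :: real^'n^'k. D ** x) \<in> borel_measurable borel"
    by (simp add: borel_measurable_continuous_onI linear_continuous_on linear_conv_bounded_linear[symmetric]
        linear_matrix_mult_left)
  have "(\<integral>\<^sup>+x. f (D ** x) \<partial>lborel) = ennreal (1 / \<bar>det D\<bar> ^ CARD('n)) * (\<integral>\<^sup>+x. f x \<partial>lborel)"
    if [measurable]: "f \<in> borel_measurable borel" for f :: "real^'n^'k \<Rightarrow> ennreal"
  proof -
    have "(\<integral>\<^sup>+x. f x \<partial>lborel) = ennreal (\<bar>det D\<bar> ^ CARD('n)) * (\<integral>\<^sup>+x. f (D ** x) \<partial>lborel)"
      by (subst leb) (simp add: nn_integral_density nn_integral_distr nn_integral_cmult)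
    then show ?thesis
      using pos by (simp add: mult.assoc[symmetric] ennreal_mult[symmetric])
  qed
  then show ?thesis
    using pos unfolding scales_lborel_def by simp
qed

text \<open>
  Multiplication by \<open>M\<close> acts on each of the \<open>n\<close> columns of \<open>x\<close> separately, hence the exponent. Both
  sides are multiplicative in \<open>M\<close>, so it suffices to look at elementary matrices. Diagonal matrices are
  immediate and transpositions are involutions. Conjugating a shear by the diagonal matrix with a single
  entry \<open>2\<close> (and \<open>1\<close> elsewhere on the diagonal) turns it into its square, and a positive multiplicative
  quantity that equals its own square is \<open>1\<close>. The same argument gives the determinant of the shear.
\<close>

theorem scales_lborel_matrix_mult_left:
  fixes M :: "real^'k^'k"
  assumes "det M \<noteq> 0"
  shows "scales_lborel (\<lambda>x :: real^'n^'k. M ** x) (1 / \<bar>det M\<bar> ^ CARD('n))"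
proof -
  define P where "P M \<longleftrightarrow>
    (det M \<noteq> 0 \<longrightarrow> scales_lborel (\<lambda>x :: real^'n^'k. M ** x) (1 / \<bar>det M\<bar> ^ CARD('n)))"
    for M :: "real^'k^'k"
  have ex: "\<exists>c. scales_lborel (\<lambda>x :: real^'n^'k. M ** x) c" if "det M \<noteq> 0" for M :: "real^'k^'k"
    using linear_scales_lborel[OF linear_matrix_mult_left inj_matrix_mult_left[OF that]] by blast
  have mult: "scales_lborel (\<lambda>x :: real^'n^'k. (A ** B) ** x) (a * b)"
    if "scales_lborel (\<lambda>x :: real^'n^'k. A ** x) a" "scales_lborel (\<lambda>x :: real^'n^'k. B ** x) b"
    for A B :: "real^'k^'k" and a b
    using scales_lborel_compose[OF that] by (simp add: matrix_mul_assoc)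
  have diagonal: "P D" if "\<And>i j. i \<noteq> j \<Longrightarrow> D $ i $ j = 0" for D
    unfolding P_def using scales_lborel_diagonal that by blast
  have "P M"
  proof (rule induct_matrix_elementary)
    fix A B :: "real^'k^'k"
    assume "P A" "P B"
    then show "P (A ** B)"
      using mult[of A "1 / \<bar>det A\<bar> ^ CARD('n)" B "1 / \<bar>det B\<bar> ^ CARD('n)"]
      unfolding P_def by (simp add: det_mul abs_mult power_mult_distrib)
  next
    fix A :: "real^'k^'k" and i assume "row i A = 0"
    then have "det A = 0" by (rule det_zero_row)
    then show "P A" unfolding P_def by simp
  next
    fix m n :: 'k assume "m \<noteq> n"
    let ?S = "(\<chi> i j. mat 1 $ i $ Transposition.transpose m n j) :: real^'k^'k"
    have "(\<Sum>k\<in>UNIV. ?S $ i $ k * ?S $ k $ j) = mat 1 $ i $ j" for i j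
    proof -
      have "(\<Sum>k\<in>UNIV. ?S $ i $ k * ?S $ k $ j)
          = (\<Sum>k\<in>UNIV. if k = Transposition.transpose m n j then mat 1 $ i $ j else 0)"
        by (rule sum.cong) (auto simp: mat_def)
      then show ?thesis by simp
    qed
    then have SS: "?S ** ?S = mat 1"
      by (simp add: matrix_matrix_mult_def vec_eq_iff)
    have "\<bar>det ?S\<bar> = 1"
      using arg_cong[OF SS, of det] by (simp add: det_mul abs_square_eq_1 flip: power2_eq_square)
    moreover have "scales_lborel (\<lambda>x :: real^'n^'k. ?S ** x) 1"
      by (rule scales_lborel_involution) (simp_all add: linear_matrix_mult_left matrix_mul_assoc SS)
    ultimately show "P ?S" unfolding P_def by simp
  next
    fix m n :: 'k and c :: real assume mn: "m \<noteq> n"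
    let ?T = "(\<chi> i j. if i = m \<and> j = n then c else of_bool (i = j)) :: real^'k^'k"
    let ?D = "(\<chi> i j. if i = j then if i = m then 2 else 1 else 0) :: real^'k^'k"
    have detD: "det ?D \<noteq> 0"
      by (subst det_diagonal) auto
    have T: "(?T ** X) $ i $ j = X $ i $ j + (if i = m then c * X $ n $ j else 0)"
      for X :: "real^'k^'k" and i j
    proof -
      have "(?T ** X) $ i $ j = (\<Sum>k\<in>UNIV. (if k = i then X $ i $ j else 0)
          + (if k = n then if i = m then c * X $ n $ j else 0 else 0))"
        unfolding matrix_matrix_mult_def vec_lambda_beta
        by (rule sum.cong) (use mn in auto)
      then show ?thesis by (simp add: sum.distrib)
    qed
    have D: "(?D ** X) $ i $ j = (if i = m then 2 else 1) * X $ i $ j" for X :: "real^'k^'k" and i j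
    proof -
      have "(?D ** X) $ i $ j = (\<Sum>k\<in>UNIV. if k = i then (if i = m then 2 else 1) * X $ i $ j else 0)"
        unfolding matrix_matrix_mult_def vec_lambda_beta by (rule sum.cong) auto
      then show ?thesis by simp
    qed
    \<comment> \<open>Doubling row \<open>m\<close> doubles the shear parameter, and the shear with parameter \<open>2 c\<close> is the
      square of the shear with parameter \<open>c\<close>.\<close>
    have comm: "?D ** ?T = ?T ** (?T ** ?D)"
      unfolding vec_eq_iff T D using mn by auto
    show "P ?T"
    proof (cases "det ?T = 0")
      case False
      have "det ?T = 1"
        using arg_cong[OF comm, of det] False detD by (simp add: det_mul)
      moreover obtain t where t: "scales_lborel (\<lambda>x :: real^'n^'k. ?T ** x) t"
        using ex[OF False] by blast
      obtain d where d: "scales_lborel (\<lambda>x :: real^'n^'k. ?D ** x) d"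
        using ex[OF detD] by blast
      have "d * t = t * (t * d)"
        using scales_lborel_unique[OF mult[OF d t, unfolded comm] mult[OF t mult[OF t d]]] .
      moreover have "d > 0" "t > 0"
        using d t by (auto simp: scales_lborel_def)
      ultimately have "t = 1" by simp
      then show ?thesis
        using t \<open>det ?T = 1\<close> unfolding P_def by simp
    qed (simp add: P_def)
  qed (rule diagonal)
  then show ?thesis
    using assms unfolding P_def by blast
qed

lemma transpose_scales_lborel: "scales_lborel (transpose :: real^'k^'k \<Rightarrow> real^'k^'k) 1"
  by (rule scales_lborel_involution)
    (auto intro!: linearI simp: transpose_def vec_eq_iff)

lemma scales_lborel_matrix_mult_right:
  fixes R :: "real^'k^'k"
  assumes "det R \<noteq> 0"
  shows "scales_lborel (\<lambda>x :: real^'k^'k. x ** R) (1 / \<bar>det R\<bar> ^ CARD('k))"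
proof -
  have "scales_lborel (\<lambda>x :: real^'k^'k. transpose (transpose R ** transpose x)) (1 * (1 / \<bar>det (transpose R)\<bar> ^ CARD('k) * 1))"
    by (intro scales_lborel_compose transpose_scales_lborel scales_lborel_matrix_mult_left)
      (simp add: assms)
  then show ?thesis
    by (simp add: matrix_transpose_mul)
qed

section \<open>Rotations and embeddings of tuples\<close>

text \<open>
  The inclusion of index sets that underlies the natural embedding.
\<close>

definition coord_inclusion :: "'k :: {finite, linorder} \<Rightarrow> 'n :: {finite, linorder}" where
  "coord_inclusion l = inv coord_index (coord_index l)"

definition embed_tuple ::
    "real ^ 'k :: {finite, linorder} ^ 'j :: finite \<Rightarrow> real ^ 'n :: {finite, linorder} ^ 'j" where
  "embed_tuple y = (\<chi> j. natural_embedding (y $ j))"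

definition rotate_tuple :: "real ^ 'n ^ 'n \<Rightarrow> real ^ 'n ^ 'k \<Rightarrow> real ^ 'n ^ 'k" where
  "rotate_tuple Q x = (\<chi> j. Q *v (x $ j))"

lemma coord_index_less: "coord_index (i :: 'i :: {finite, linorder}) < CARD('i)"
  using bij_betw_coord_index[where 'i='i] by (auto simp: bij_betw_def)

lemma inj_coord_index: "inj (coord_index :: 'i :: {finite, linorder} \<Rightarrow> nat)"
  using bij_betw_coord_index[where 'i='i] by (auto simp: bij_betw_def)

lemma coord_index_inv:
  "m < CARD('i) \<Longrightarrow> coord_index (inv coord_index m :: 'i :: {finite, linorder}) = m"
  using bij_betw_coord_index[where 'i='i] by (auto simp: bij_betw_def intro!: f_inv_into_f)

context
  assumes card_le: "CARD('k :: {finite, linorder}) \<le> CARD('n :: {finite, linorder})"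
begin

lemma coord_index_inclusion: "coord_index (coord_inclusion (l :: 'k) :: 'n) = coord_index l"
  unfolding coord_inclusion_def using coord_index_less[of l] card_le by (intro coord_index_inv) simp

lemma inj_coord_inclusion: "inj (coord_inclusion :: 'k \<Rightarrow> 'n)"
  by (metis coord_index_inclusion inj_coord_index injD injI)

lemma natural_embedding_component:
  "natural_embedding (y :: (real, 'k) vec) $ (coord_inclusion l :: 'n) = y $ l"
  by (simp add: natural_embedding_def coord_index_inclusion coord_index_less inv_f_f inj_coord_index)

lemma natural_embedding_component_0:
  assumes "i \<notin> range (coord_inclusion :: 'k \<Rightarrow> 'n)"
  shows "natural_embedding (y :: (real, 'k) vec) $ i = 0"
proof -
  have "\<not> coord_index i < CARD('k)"
  proof
    assume "coord_index i < CARD('k)"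
    then have "i = coord_inclusion (inv coord_index (coord_index i) :: 'k)"
      by (metis coord_index_inclusion coord_index_inv inj_coord_index injD)
    with assms show False by blast
  qed
  then show ?thesis by (simp add: natural_embedding_def)
qed

lemma natural_embedding_inner:
  "(natural_embedding a :: (real, 'n) vec) \<bullet> natural_embedding b = (a :: (real, 'k) vec) \<bullet> b"
proof -
  have "(natural_embedding a :: (real, 'n) vec) \<bullet> natural_embedding b
      = (\<Sum>i\<in>range (coord_inclusion :: 'k \<Rightarrow> 'n). natural_embedding a $ i * natural_embedding b $ i)"
    unfolding inner_vec_def inner_real_def
    by (rule sum.mono_neutral_right) (auto simp: natural_embedding_component_0)
  also have "\<dots> = a \<bullet> b"
    unfolding inner_vec_def inner_real_def
    by (subst sum.reindex[OF inj_coord_inclusion]) (simp add: natural_embedding_component)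
  finally show ?thesis .
qed

lemma natural_embedding_surj:
  assumes "\<And>i. i \<notin> range (coord_inclusion :: 'k \<Rightarrow> 'n) \<Longrightarrow> v $ i = 0"
  obtains a :: "(real, 'k) vec" where "natural_embedding a = v"
proof
  show "natural_embedding (\<chi> l :: 'k. v $ coord_inclusion l) = v"
  proof (unfold vec_eq_iff, rule allI)
    fix i :: 'n
    show "natural_embedding (\<chi> l :: 'k. v $ coord_inclusion l) $ i = v $ i"
      by (cases "i \<in> range (coord_inclusion :: 'k \<Rightarrow> 'n)")
        (auto simp: natural_embedding_component natural_embedding_component_0 assms)
  qed
qed

lemma embed_tuple_mult: "embed_tuple (M ** y) = M ** (embed_tuple (y :: ('k, 'j :: finite) vec_tuple) :: ('n, 'j :: finite) vec_tuple)"
proof -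
  have "embed_tuple (M ** y) $ j $ i = (M ** embed_tuple y) $ j $ i" for j and i :: 'n
  proof (cases "i \<in> range (coord_inclusion :: 'k \<Rightarrow> 'n)")
    case True
    then show ?thesis
      by (auto simp: embed_tuple_def natural_embedding_component matrix_matrix_mult_def)
  next
    case False
    then show ?thesis
      by (simp add: embed_tuple_def natural_embedding_component_0 matrix_matrix_mult_def)
  qed
  then show ?thesis by (simp add: vec_eq_iff)
qed

lemma embed_tuple_gram:
  "(embed_tuple y :: ('n, 'j :: finite) vec_tuple) ** transpose (embed_tuple y) = y ** transpose (y :: ('k, 'j :: finite) vec_tuple)"
  using natural_embedding_inner
  by (simp add: vec_eq_iff matrix_matrix_mult_def transpose_def embed_tuple_def inner_vec_def)

lemma norm_embed_tuple: "norm (embed_tuple y :: ('n, 'j :: finite) vec_tuple) = norm (y :: ('k, 'j :: finite) vec_tuple)"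
  unfolding norm_eq_sqrt_inner embed_tuple_def inner_vec_def[of "vec_lambda _"] inner_vec_def[of y]
  by (simp add: natural_embedding_inner)

lemma continuous_embed_tuple: "continuous_on UNIV (embed_tuple :: ('k, 'j :: finite) vec_tuple \<Rightarrow> ('n, 'j :: finite) vec_tuple)"
proof -
  have "continuous_on UNIV (\<lambda>y :: ('k, 'j :: finite) vec_tuple. natural_embedding (y $ j) $ (i :: 'n))" for i j
    unfolding natural_embedding_def by (cases "coord_index i < CARD('k)") (auto intro!: continuous_intros)
  then have "continuous_on UNIV (\<lambda>y :: ('k, 'j :: finite) vec_tuple. \<chi> j i. natural_embedding (y $ j) $ (i :: 'n))"
    by (intro continuous_on_vec_lambda)
  then show ?thesis
    by (simp add: embed_tuple_def)
qed

text \<open>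
  The \<open>k\<close> vectors span a space \<open>S\<close> of dimension at most \<open>k\<close>. Take orthonormal bases of \<open>S\<close> and of its
  orthogonal complement and number their union by the coordinates of \<open>n\<close>-space so that the basis of \<open>S\<close>
  occupies some of the first \<open>k\<close> places. The orthogonal matrix \<open>Q\<close> whose columns are these vectors maps
  the embedded \<open>k\<close>-space onto a space that contains \<open>S\<close>.
\<close>

lemma exists_rotated_embedding:
  fixes x :: "('n, 'k) vec_tuple"
  obtains Q r where "orthogonal_matrix Q" "x = rotate_tuple Q (embed_tuple (r :: ('k, 'k) vec_tuple))"
proof -
  define S where "S = span (range (($) x))"
  have "subspace S" by (simp add: S_def)
  obtain B where B: "B \<subseteq> S" "pairwise orthogonal B" "\<And>b. b \<in> B \<Longrightarrow> norm b = 1"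
      "independent B" "card B = dim S" "span B = S"
    using orthonormal_basis_subspace[OF \<open>subspace S\<close>] by metis
  define T where "T = {y. \<forall>x\<in>S. orthogonal x y}"
  have "subspace T" unfolding T_def by (rule subspace_orthogonal_to_vectors)
  obtain B' where B': "B' \<subseteq> T" "pairwise orthogonal B'" "\<And>b. b \<in> B' \<Longrightarrow> norm b = 1"
      "independent B'" "card B' = dim T" "span B' = T"
    using orthonormal_basis_subspace[OF \<open>subspace T\<close>] by metis
  have fin: "finite B" "finite B'"
    using B(4) B'(4) by (auto dest: independent_imp_finite)
  have disj: "B \<inter> B' = {}"
  proof -
    have "False" if "b \<in> B" "b \<in> B'" for b
    proof -
      have "orthogonal b b" using that B(1) B'(1) unfolding T_def by blast
      then show False using B(3)[OF that(1)] by (simp add: orthogonal_self)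
    qed
    then show ?thesis by blast
  qed
  have "dim S + dim T = CARD('n)"
    using dim_subspace_orthogonal_to_vectors[OF \<open>subspace S\<close> subspace_UNIV] unfolding T_def by simp
  have "card B \<le> card (range (coord_inclusion :: 'k \<Rightarrow> 'n))"
  proof -
    have "dim S \<le> card (range (($) x))"
      unfolding S_def using dim_le_card'[of "range (($) x)"] by simp
    also have "\<dots> \<le> CARD('k)" by (rule card_image_le) simp
    finally show ?thesis
      by (simp add: B(5) card_image inj_coord_inclusion)
  qed
  then obtain K where K: "K \<subseteq> range (coord_inclusion :: 'k \<Rightarrow> 'n)" "card K = card B"
    by (meson obtain_subset_with_card_n)
  obtain f where f: "bij_betw f K B"
    by (meson K(2) fin(1) finite finite_same_card_bij)
  have "card (- K) = card B'"
    using K(2) \<open>dim S + dim T = CARD('n)\<close> B(5) B'(5) by (simp add: Compl_eq_Diff_UNIV card_Diff_subset)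
  then obtain g where g: "bij_betw g (- K) B'"
    by (meson fin(2) finite finite_same_card_bij)
  define h where "h i = (if i \<in> K then f i else g i)" for i
  have hK: "h i \<in> B" if "i \<in> K" for i using f that unfolding h_def by (auto simp: bij_betw_def)
  have hK': "h i \<in> B'" if "i \<notin> K" for i using g that unfolding h_def by (auto simp: bij_betw_def)
  have "inj h"
  proof (rule injI)
    fix i j assume "h i = h j"
    then have "i \<in> K \<longleftrightarrow> j \<in> K" using hK hK' disj by (metis disjoint_iff)
    moreover have "inj_on f K" "inj_on g (- K)"
      using f g by (simp_all add: bij_betw_def)
    ultimately show "i = j"
      using \<open>h i = h j\<close> unfolding h_def by (cases "i \<in> K") (auto dest: inj_onD)
  qed
  have orth: "orthogonal (h i) (h j)" if "i \<noteq> j" for i j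
  proof -
    have ne: "h i \<noteq> h j" using that \<open>inj h\<close> by (metis injD)
    have cross: "orthogonal a b" if "a \<in> B" "b \<in> B'" for a b
      using that B(1) B'(1) unfolding T_def by blast
    show ?thesis
    proof (cases "i \<in> K"; cases "j \<in> K")
      assume "i \<in> K" "j \<in> K"
      then show ?thesis using ne hK B(2) unfolding pairwise_def by blast
    next
      assume "i \<notin> K" "j \<notin> K"
      then show ?thesis using ne hK' B'(2) unfolding pairwise_def by blast
    qed (use cross hK hK' orthogonal_commute in blast)+
  qed
  define Q :: "('n, 'n) vec_tuple" where "Q = (\<chi> i j. h j $ i)"
  have colQ: "column j Q = h j" for j
    by (simp add: Q_def column_def)
  have Q: "orthogonal_matrix Q"
    unfolding orthogonal_matrix_orthonormal_columns colQ
    using orth hK hK' B(3) B'(3) by metis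
  have "\<exists>a :: (real, 'k) vec. natural_embedding a = transpose Q *v (x $ j)" for j
  proof -
    have "(transpose Q *v (x $ j)) $ i = 0" if "i \<notin> range (coord_inclusion :: 'k \<Rightarrow> 'n)" for i
    proof -
      have "h i \<in> T" using that K(1) hK' B'(1) by blast
      moreover have "x $ j \<in> S" unfolding S_def by (simp add: span_base)
      ultimately have "h i \<bullet> x $ j = 0"
        unfolding T_def orthogonal_def by (auto simp: inner_commute)
      then show ?thesis
        by (simp add: matrix_vector_mult_def transpose_def Q_def inner_vec_def)
    qed
    then show ?thesis by (metis natural_embedding_surj)
  qed
  then obtain r :: "'k \<Rightarrow> (real, 'k) vec" where r: "natural_embedding (r j) = transpose Q *v (x $ j)" for j
    by metis
  have "Q *v (transpose Q *v (x $ j)) = x $ j" for j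
    using Q by (simp only: orthogonal_matrix_def matrix_vector_mul_assoc matrix_vector_mul_lid)
  then have "x = rotate_tuple Q (embed_tuple (\<chi> j. r j))"
    unfolding rotate_tuple_def embed_tuple_def vec_lambda_beta r by (simp add: vec_lambda_eta)
  with Q that show thesis by blast
qed

end

lemma rotate_tuple_eq_mult: "rotate_tuple Q x = x ** transpose Q"
  by (simp add: rotate_tuple_def vec_eq_iff matrix_matrix_mult_def matrix_vector_mult_def
      transpose_def mult.commute)

lemma rotate_tuple_mult: "rotate_tuple Q (M ** x) = M ** rotate_tuple Q x"
  by (simp add: rotate_tuple_eq_mult matrix_mul_assoc)

lemma rotate_tuple_gram:
  assumes "orthogonal_matrix Q"
  shows "rotate_tuple Q x ** transpose (rotate_tuple Q x) = x ** transpose x"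
proof -
  have "rotate_tuple Q x ** transpose (rotate_tuple Q x) = x ** (transpose Q ** Q) ** transpose x"
    by (simp add: rotate_tuple_eq_mult matrix_transpose_mul matrix_mul_assoc)
  then show ?thesis
    using assms by (simp add: orthogonal_matrix)
qed

text \<open>
  The Gram matrix determines the norm, so the norm is invariant under rotation of the tuple.
\<close>

lemma norm_eq_trace_gram: "norm (x :: real ^ 'n ^ 'k) = sqrt (trace (x ** transpose x))"
  by (simp add: norm_eq_sqrt_inner inner_vec_def trace_def matrix_matrix_mult_def transpose_def)

lemma norm_rotate_tuple: "orthogonal_matrix Q \<Longrightarrow> norm (rotate_tuple Q x) = norm x"
  by (simp add: norm_eq_trace_gram rotate_tuple_gram)

section \<open>Measurability of matrix operations\<close>

text \<open>
  The inverse matrix, written with Cramer's rule so that its entries are visibly Borel functions of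
  \<open>M\<close>.
\<close>

definition cramer_inverse :: "real ^ 'k ^ 'k \<Rightarrow> real ^ 'k ^ 'k" where
  "cramer_inverse M = (\<chi> k c. det (\<chi> i j. if j = k then mat 1 $ i $ c else M $ i $ j) / det M)"

lemma cramer_inverse_right:
  assumes "det M \<noteq> 0"
  shows "M ** cramer_inverse M = mat 1"
proof -
  have "M *v (\<chi> k. cramer_inverse M $ k $ c) = (\<chi> i. mat 1 $ i $ c)" for c
    unfolding cramer[OF assms] by (simp only: cramer_inverse_def vec_lambda_beta)
  then show ?thesis
    by (simp add: vec_eq_iff matrix_matrix_mult_def matrix_vector_mult_def)
qed

lemma cramer_inverse_left: "det M \<noteq> 0 \<Longrightarrow> cramer_inverse M ** M = mat 1"
  using cramer_inverse_right matrix_left_right_inverse by blast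

lemma det_borel_measurable:
  fixes f :: "'a \<Rightarrow> real ^ 'k ^ 'k"
  assumes "\<And>i j. (\<lambda>x. f x $ i $ j) \<in> borel_measurable M"
  shows "(\<lambda>x. det (f x)) \<in> borel_measurable M"
  unfolding det_def using assms by measurable

lemma borel_measurable_matrix:
  fixes f :: "'a \<Rightarrow> real ^ 'n ^ 'k"
  assumes "\<And>i j. (\<lambda>x. f x $ i $ j) \<in> borel_measurable M"
  shows "f \<in> borel_measurable M"
  by (subst borel_measurable_euclidean_space) (auto simp: Basis_vec_def inner_axis assms)

lemma borel_measurable_entry [measurable (raw)]:
  "f \<in> borel_measurable M \<Longrightarrow> (\<lambda>x. (f x :: real ^ 'n ^ 'k) $ i $ j) \<in> borel_measurable M"
  by (rule borel_measurable_continuous_on) (auto intro!: continuous_intros)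

lemma borel_measurable_matrix_mult [measurable (raw)]:
  fixes f :: "'a \<Rightarrow> real ^ 'm ^ 'k" and g :: "'a \<Rightarrow> real ^ 'n ^ 'm"
  assumes [measurable]: "f \<in> borel_measurable M" "g \<in> borel_measurable M"
  shows "(\<lambda>x. f x ** g x) \<in> borel_measurable M"
  by (rule borel_measurable_matrix) (simp add: matrix_matrix_mult_def)

lemma borel_measurable_det [measurable (raw)]:
  fixes f :: "'a \<Rightarrow> real ^ 'k ^ 'k"
  assumes [measurable]: "f \<in> borel_measurable M"
  shows "(\<lambda>x. det (f x)) \<in> borel_measurable M"
  by (rule det_borel_measurable) measurable

lemma borel_measurable_transpose [measurable (raw)]:
  fixes f :: "'a \<Rightarrow> real ^ 'n ^ 'k"
  assumes [measurable]: "f \<in> borel_measurable M"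
  shows "(\<lambda>x. transpose (f x)) \<in> borel_measurable M"
  by (rule borel_measurable_matrix) (simp add: transpose_def)

lemma borel_measurable_cramer_inverse [measurable (raw)]:
  fixes f :: "'a \<Rightarrow> real ^ 'k ^ 'k"
  assumes [measurable]: "f \<in> borel_measurable M"
  shows "(\<lambda>x. cramer_inverse (f x)) \<in> borel_measurable M"
proof (rule borel_measurable_matrix)
  fix k c
  have [measurable]: "(\<lambda>x. det (\<chi> i j. if j = k then mat 1 $ i $ c else f x $ i $ j)) \<in> borel_measurable M"
  proof (rule det_borel_measurable)
    show "(\<lambda>x. (\<chi> i j. if j = k then mat 1 $ i $ c else f x $ i $ j) $ i $ j) \<in> borel_measurable M" for i j
      by (cases "j = k") simp_all
  qed
  show "(\<lambda>x. cramer_inverse (f x) $ k $ c) \<in> borel_measurable M"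
    unfolding cramer_inverse_def by simp
qed

section \<open>Tuples with singular Gram matrix\<close>

text \<open>
  Averaging the translates of \<open>E\<close> by \<open>t v\<close> over \<open>0 \<le> t \<le> 1\<close> does not change the measure, and after
  exchanging the integrals the inner one, over \<open>t\<close>, vanishes.
\<close>

lemma null_if_countable_on_lines:
  fixes E :: "'a::euclidean_space set"
  assumes E [measurable]: "E \<in> sets borel"
    and lines: "\<And>x. countable {t. x + t *\<^sub>R v \<in> E}"
  shows "emeasure lborel E = 0"
proof -
  have "emeasure lborel E = (\<integral>\<^sup>+t. indicator {0..1::real} t * (\<integral>\<^sup>+x. indicator E x \<partial>lborel) \<partial>lborel)"
    by (simp add: nn_integral_multc)
  also have "\<dots> = (\<integral>\<^sup>+t. \<integral>\<^sup>+x. indicator {0..1} t * indicator E (x + t *\<^sub>R v) \<partial>lborel \<partial>lborel)"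
  proof (rule nn_integral_cong)
    fix t :: real
    show "indicator {0..1} t * (\<integral>\<^sup>+x. indicator E x \<partial>lborel)
        = (\<integral>\<^sup>+x. indicator {0..1} t * indicator E (x + t *\<^sub>R v) \<partial>lborel)"
      using nn_integral_lborel_shift[of "indicator E" "t *\<^sub>R v"]
      by (simp add: nn_integral_cmult add.commute)
  qed
  also have "\<dots> = (\<integral>\<^sup>+x. \<integral>\<^sup>+t. indicator {0..1} t * indicator E (x + t *\<^sub>R v) \<partial>lborel \<partial>lborel)"
    by (rule lborel_pair.Fubini') measurable
  also have "\<dots> = (\<integral>\<^sup>+x. 0 \<partial>(lborel :: 'a measure))"
  proof (rule nn_integral_cong)
    fix x
    have "AE t in lborel. t \<notin> {t. x + t *\<^sub>R v \<in> E}"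
      by (intro AE_not_in countable_imp_null_set_lborel lines)
    then have "(\<integral>\<^sup>+t. indicator {0..1} t * indicator E (x + t *\<^sub>R v) \<partial>lborel) = (\<integral>\<^sup>+(t::real). 0 \<partial>lborel)"
      by (intro nn_integral_cong_AE) (auto elim: AE_mp)
    then show "(\<integral>\<^sup>+t. indicator {0..1} t * indicator E (x + t *\<^sub>R v) \<partial>lborel) = 0"
      by simp
  qed
  finally show ?thesis by simp
qed

lemma poly_det:
  fixes P :: "real poly ^ 'k ^ 'k"
  shows "poly (det P) t = det (\<chi> i j. poly (P $ i $ j) t)"
  by (simp add: det_def poly_sum poly_prod)

text \<open>
  The Gram determinant is a polynomial along the line. That it is not the zero polynomial is seen at the
  point at infinity: \<open>x + t v\<close> and \<open>v + x / t\<close> have Gram determinants that vanish together, and the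
  latter line passes through \<open>v\<close>. So the polynomial in \<open>s = 1 / t\<close> is the convenient one.
\<close>

lemma finite_singular_gram_on_line:
  fixes x v :: "real ^ 'n ^ 'k"
  assumes v: "det (v ** transpose v) \<noteq> 0"
  shows "finite {t. det ((x + t *\<^sub>R v) ** transpose (x + t *\<^sub>R v)) = 0}"
proof -
  define P :: "real poly ^ 'k ^ 'k" where
    "P = (\<chi> i j. \<Sum>c\<in>UNIV. [:v $ i $ c, x $ i $ c:] * [:v $ j $ c, x $ j $ c:])"
  have P: "poly (det P) s = det ((v + s *\<^sub>R x) ** transpose (v + s *\<^sub>R x))" for s
    unfolding poly_det by (simp add: P_def poly_sum matrix_matrix_mult_def transpose_def algebra_simps)
  have "poly (det P) 0 \<noteq> 0"
    using v unfolding P by simp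
  then have fin: "finite {s. poly (det P) s = 0}"
    by (intro poly_roots_finite) auto
  have "t = 0 \<or> inverse t \<in> {s. poly (det P) s = 0}"
    if t: "det ((x + t *\<^sub>R v) ** transpose (x + t *\<^sub>R v)) = 0" for t
  proof (cases "t = 0")
    case False
    let ?G = "(v + inverse t *\<^sub>R x) ** transpose (v + inverse t *\<^sub>R x)"
    have "x + t *\<^sub>R v = t *\<^sub>R (v + inverse t *\<^sub>R x)"
      using False by (simp add: algebra_simps)
    then have "(x + t *\<^sub>R v) ** transpose (x + t *\<^sub>R v) = (\<chi> i. t\<^sup>2 *s ?G $ i)"
      by (simp add: vec_eq_iff matrix_matrix_mult_def transpose_def sum_distrib_left power2_eq_square mult_ac)
    then have "det ((x + t *\<^sub>R v) ** transpose (x + t *\<^sub>R v)) = (\<Prod>i\<in>(UNIV::'k set). t\<^sup>2) * det ?G"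
      by (simp add: det_rows_mul)
    then have "det ?G = 0" using t False by simp
    then show ?thesis by (simp add: P)
  qed simp
  then have "{t. det ((x + t *\<^sub>R v) ** transpose (x + t *\<^sub>R v)) = 0}
      \<subseteq> insert 0 (inverse ` {s. poly (det P) s = 0})"
    by (auto intro!: image_eqI[where x="inverse _"])
  then show ?thesis
    using fin by (meson finite.insertI finite_imageI finite_subset)
qed

text \<open>
  Lines in the direction of an orthonormal \<open>k\<close>-tuple meet the singular set in finitely many points.
\<close>

lemma AE_gram_nonsingular:
  assumes "CARD('k :: {finite, linorder}) \<le> CARD('n :: {finite, linorder})"
  shows "AE x in lborel. det ((x :: ('n, 'k) vec_tuple) ** transpose x) \<noteq> 0"
proof -
  let ?v = "embed_tuple (mat 1 :: ('k, 'k) vec_tuple) :: ('n, 'k) vec_tuple"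
  let ?E = "{x :: ('n, 'k) vec_tuple. det (x ** transpose x) = 0}"
  have [measurable]: "?E \<in> sets borel"
    by measurable
  have "det (?v ** transpose ?v) \<noteq> 0"
    by (simp add: embed_tuple_gram[OF assms] transpose_mat)
  then have "emeasure lborel ?E = 0"
    by (intro null_if_countable_on_lines[where v="?v"])
      (auto intro: countable_finite finite_singular_gram_on_line)
  then show ?thesis
    by (intro AE_I[where N="?E"]) auto
qed

lemma AE_det_nonzero: "AE M in lborel. det (M :: ('k :: {finite, linorder}, 'k) vec_tuple) \<noteq> 0"
  using AE_gram_nonsingular[where 'n='k and 'k='k] by (simp add: det_mul det_transpose)

section \<open>The integral formula for nonnegative Borel functions\<close>

definition orthogonally_invariant :: "(real ^ 'n ^ 'k \<Rightarrow> 'b) \<Rightarrow> bool" where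
  "orthogonally_invariant F \<longleftrightarrow>
    (\<forall>Q x. orthogonal_matrix Q \<longrightarrow> F (rotate_tuple Q x) = F x)"

text \<open>
  The right-hand side of the integral formula, without its constant.
\<close>

definition square_part :: "(('n :: {finite, linorder}, 'k :: {finite, linorder}) vec_tuple \<Rightarrow> ennreal) \<Rightarrow> ennreal" where
  "square_part F = (\<integral>\<^sup>+y.
     F (embed_tuple (y :: ('k, 'k) vec_tuple)) * ennreal (\<bar>det y\<bar> ^ (CARD('n) - CARD('k))) \<partial>lborel)"

text \<open>
  The test function of the double integral. The Gram determinant of \<open>z\<close> to the power \<open>n / 2\<close> is there to
  cancel the Jacobian in \<open>square_part_translate\<close>; the ball makes the integral finite.
\<close>

definition gram_density :: "real ^ 'n ^ 'k \<Rightarrow> ennreal" where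
  "gram_density z = indicator (cball 0 1) z * ennreal (sqrt (det (z ** transpose z)) ^ CARD('n))"

lemma borel_measurable_embed_tuple:
  assumes "CARD('k :: {finite, linorder}) \<le> CARD('n :: {finite, linorder})"
    and [measurable]: "f \<in> borel_measurable M"
  shows "(\<lambda>x. embed_tuple (f x :: ('k, 'j :: finite) vec_tuple) :: ('n, 'j) vec_tuple) \<in> borel_measurable M"
  by (rule borel_measurable_continuous_on[OF continuous_embed_tuple[OF assms(1)] assms(2)])

lemma borel_measurable_gram_density [measurable]:
  "gram_density \<in> borel_measurable (borel :: (real ^ 'n ^ 'k) measure)"
proof -
  have [measurable]: "cball (0 :: real ^ 'n ^ 'k) 1 \<in> sets borel" by simp
  show ?thesis unfolding gram_density_def[abs_def] by measurable
qed

lemma gram_density_rotate: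
  "orthogonal_matrix Q \<Longrightarrow> gram_density (rotate_tuple Q z) = gram_density z"
  by (simp add: gram_density_def rotate_tuple_gram indicator_def norm_rotate_tuple)

lemma AE_rotated_embedding:
  assumes "CARD('k :: {finite, linorder}) \<le> CARD('n :: {finite, linorder})"
  shows "AE z in lborel. \<exists>Q r. orthogonal_matrix Q \<and> det r \<noteq> 0 \<and>
    z = (rotate_tuple Q (embed_tuple (r :: ('k, 'k) vec_tuple)) :: ('n, 'k) vec_tuple)"
  using AE_gram_nonsingular[OF assms]
proof (rule AE_mp, intro AE_I2 impI)
  fix z :: "('n, 'k) vec_tuple"
  assume z: "det (z ** transpose z) \<noteq> 0"
  obtain Q and r :: "('k, 'k) vec_tuple" where Qr: "orthogonal_matrix Q" "z = rotate_tuple Q (embed_tuple r)"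
    using exists_rotated_embedding[OF assms] by blast
  then have "det (z ** transpose z) = det r * det r"
    by (simp add: rotate_tuple_gram embed_tuple_gram[OF assms] det_mul det_transpose)
  with z Qr show "\<exists>Q r. orthogonal_matrix Q \<and> det r \<noteq> 0 \<and>
      z = rotate_tuple Q (embed_tuple (r :: ('k, 'k) vec_tuple))"
    by auto
qed

lemma gram_density_embed:
  assumes "CARD('k :: {finite, linorder}) \<le> CARD('n :: {finite, linorder})"
  shows "gram_density (embed_tuple (r :: ('k, 'k) vec_tuple) :: ('n, 'k) vec_tuple)
    = indicator (cball 0 1) r * ennreal (\<bar>det r\<bar> ^ CARD('n))"
  by (simp add: gram_density_def embed_tuple_gram[OF assms] det_mul det_transpose indicator_def
      norm_embed_tuple[OF assms] real_sqrt_mult_self)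

text \<open>
  The measure with density \<open>|det M|\<close> to the power \<open>n - k\<close> on square matrices is multiplied by
  \<open>|det r|\<close> to the power \<open>-n\<close> under the substitution of \<open>M r\<close> for \<open>M\<close>: the exponent \<open>k\<close> is due to Lebesgue
  measure and \<open>n - k\<close> to the density.
\<close>

lemma square_part_translate:
  fixes r :: "('k :: {finite, linorder}, 'k) vec_tuple"
    and F :: "('n :: {finite, linorder}, 'k) vec_tuple \<Rightarrow> ennreal"
  assumes le: "CARD('k) \<le> CARD('n)"
    and [measurable]: "F \<in> borel_measurable borel" and r: "det r \<noteq> 0"
  shows "(\<integral>\<^sup>+M. F (embed_tuple (M ** r)) * ennreal (\<bar>det M\<bar> ^ (CARD('n) - CARD('k))) \<partial>lborel)
    * ennreal (\<bar>det r\<bar> ^ CARD('n)) = square_part F"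
proof -
  note [measurable] = borel_measurable_embed_tuple[OF le]
  let ?w = "\<lambda>M :: ('k, 'k) vec_tuple. ennreal (\<bar>det M\<bar> ^ (CARD('n) - CARD('k)))"
  let ?I = "\<integral>\<^sup>+M. F (embed_tuple (M ** r)) * ?w M \<partial>lborel"
  have "ennreal (1 / \<bar>det r\<bar> ^ CARD('k)) * square_part F
      = (\<integral>\<^sup>+M. F (embed_tuple (M ** r)) * ?w (M ** r) \<partial>lborel)"
    using scales_lborel_matrix_mult_right[OF r] unfolding scales_lborel_def square_part_def
    by (auto elim!: allE[where x="\<lambda>y. F (embed_tuple y) * ?w y"])
  also have "\<dots> = (\<integral>\<^sup>+M. F (embed_tuple (M ** r)) * ?w M * ?w r \<partial>lborel)"
    by (simp add: det_mul abs_mult power_mult_distrib ennreal_mult mult.assoc)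
  also have "\<dots> = ?I * ?w r"
    by (rule nn_integral_multc) measurable
  finally have "ennreal (1 / \<bar>det r\<bar> ^ CARD('k)) * square_part F = ?I * ?w r" .
  note unscaled = this
  have "?I * (?w r * ennreal (\<bar>det r\<bar> ^ CARD('k))) = ennreal (\<bar>det r\<bar> ^ CARD('k)) * (?I * ?w r)"
    by (simp only: mult_ac)
  also have "\<dots> = ennreal (\<bar>det r\<bar> ^ CARD('k)) * ennreal (1 / \<bar>det r\<bar> ^ CARD('k)) * square_part F"
    unfolding unscaled[symmetric] by (simp only: mult_ac)
  finally have "?I * (?w r * ennreal (\<bar>det r\<bar> ^ CARD('k)))
      = ennreal (\<bar>det r\<bar> ^ CARD('k)) * ennreal (1 / \<bar>det r\<bar> ^ CARD('k)) * square_part F" .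
  then show ?thesis
    using le r by (simp add: ennreal_mult[symmetric] power_add[symmetric])
qed

text \<open>
  The measure with density \<open>|det M|\<close> to the power \<open>-k\<close> is the Haar measure of the general linear group, so
  the substitution of \<open>r M\<close> for \<open>M\<close> removes \<open>r\<close>. The rotation \<open>Q\<close> disappears because the test function is
  orthogonally invariant. Consequently the integral is the same for almost all tuples in place of
  \<open>rotate_tuple Q (embed_tuple r)\<close>.
\<close>

lemma gram_density_translate:
  fixes r :: "('k :: {finite, linorder}, 'k) vec_tuple"
    and Q :: "('n :: {finite, linorder}, 'n) vec_tuple"
  assumes le: "CARD('k) \<le> CARD('n)" and r: "det r \<noteq> 0" and Q: "orthogonal_matrix Q"
  shows "(\<integral>\<^sup>+M. gram_density (cramer_inverse M ** rotate_tuple Q (embed_tuple r))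
      * ennreal (1 / \<bar>det M\<bar> ^ CARD('k)) \<partial>lborel)
    = (\<integral>\<^sup>+M. gram_density (embed_tuple (cramer_inverse M) :: ('n, 'k) vec_tuple)
      * ennreal (1 / \<bar>det M\<bar> ^ CARD('k)) \<partial>lborel)"
proof -
  note [measurable] = borel_measurable_embed_tuple[OF le]
  let ?x = "rotate_tuple Q (embed_tuple r)"
  let ?v = "\<lambda>M :: ('k, 'k) vec_tuple. ennreal (1 / \<bar>det M\<bar> ^ CARD('k))"
  let ?g = "\<lambda>M. gram_density (cramer_inverse M ** ?x) * ?v M"
  have pos: "\<bar>det r\<bar> ^ CARD('k) > 0" using r by simp
  have "ennreal (1 / \<bar>det r\<bar> ^ CARD('k)) * (\<integral>\<^sup>+M. ?g M \<partial>lborel) = (\<integral>\<^sup>+M. ?g (r ** M) \<partial>lborel)"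
    using scales_lborel_matrix_mult_left[OF r, where 'n='k] unfolding scales_lborel_def
    by (auto elim!: allE[where x="?g"])
  also have "\<dots> = (\<integral>\<^sup>+M. ?v r * (gram_density (embed_tuple (cramer_inverse M) :: ('n, 'k) vec_tuple) * ?v M) \<partial>lborel)"
  proof (rule nn_integral_cong_AE, use AE_det_nonzero in eventually_elim)
    fix M :: "('k, 'k) vec_tuple" assume M: "det M \<noteq> 0"
    have "cramer_inverse (r ** M) ** r = cramer_inverse (r ** M) ** (r ** (M ** cramer_inverse M))"
      by (simp add: cramer_inverse_right[OF M])
    also have "\<dots> = cramer_inverse M"
      using cramer_inverse_left[of "r ** M"] M r
      by (simp add: matrix_mul_assoc det_mul)
    finally have "cramer_inverse (r ** M) ** ?x = rotate_tuple Q (embed_tuple (cramer_inverse M))"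
      by (simp flip: rotate_tuple_mult embed_tuple_mult[OF le])
    then have "gram_density (cramer_inverse (r ** M) ** ?x)
        = gram_density (embed_tuple (cramer_inverse M) :: ('n, 'k) vec_tuple)"
      by (simp add: gram_density_rotate Q)
    moreover have "?v (r ** M) = ?v r * ?v M"
      by (simp add: det_mul abs_mult power_mult_distrib ennreal_mult[symmetric])
    ultimately show "?g (r ** M) = ?v r * (gram_density (embed_tuple (cramer_inverse M) :: ('n, 'k) vec_tuple) * ?v M)"
      by (simp add: mult_ac)
  qed
  also have "\<dots> = ?v r * (\<integral>\<^sup>+M. gram_density (embed_tuple (cramer_inverse M) :: ('n, 'k) vec_tuple) * ?v M \<partial>lborel)"
    by (rule nn_integral_cmult) measurable
  finally show ?thesis
    using pos by (simp add: ennreal_mult_cancel_left)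
qed

text \<open>
  Both sides equal the integral of \<open>h(z) F(M z) |det M|^(n-k)\<close> over all tuples \<open>z\<close> and all square
  matrices \<open>M\<close>, where \<open>h\<close> is \<open>gram_density\<close>. If the integration over \<open>M\<close> is the inner one and \<open>z\<close> is a
  rotation of an embedded matrix \<open>r\<close>, then invariance replaces \<open>F(M z)\<close> by the value of \<open>F\<close> at the embedded
  matrix \<open>M r\<close>, and only \<open>F\<close> on embedded tuples enters. If the integration over \<open>z\<close> is the inner one, then the
  substitution \<open>x = M z\<close> separates \<open>F(x)\<close> from a factor whose integral over \<open>M\<close> is independent of \<open>x\<close>.
\<close>

lemma nn_integral_invariant_proportional:
  fixes F :: "('n :: {finite, linorder}, 'k :: {finite, linorder}) vec_tuple \<Rightarrow> ennreal"
  assumes le: "CARD('k) \<le> CARD('n)"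
    and F [measurable]: "F \<in> borel_measurable borel" and inv: "orthogonally_invariant F"
  shows "emeasure lborel (cball (0 :: ('n, 'k) vec_tuple) 1) * square_part F
    = (\<integral>\<^sup>+x. F x \<partial>lborel) * (\<integral>\<^sup>+M. gram_density (embed_tuple (cramer_inverse M) :: ('n, 'k) vec_tuple)
      * ennreal (1 / \<bar>det (M :: ('k, 'k) vec_tuple)\<bar> ^ CARD('k)) \<partial>lborel)"
    (is "_ = _ * ?A")
proof -
  note [measurable] = borel_measurable_embed_tuple[OF le]
  let ?w = "\<lambda>M :: ('k, 'k) vec_tuple. ennreal (\<bar>det M\<bar> ^ (CARD('n) - CARD('k)))"
  let ?h = "gram_density :: ('n, 'k) vec_tuple \<Rightarrow> ennreal"
  have F_rot: "F (rotate_tuple Q x) = F x" if "orthogonal_matrix Q" for Q x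
    using inv that by (simp add: orthogonally_invariant_def)
  have "emeasure lborel (cball (0 :: ('n, 'k) vec_tuple) 1) * square_part F
      = (\<integral>\<^sup>+z. indicator (cball (0 :: ('n, 'k) vec_tuple) 1) z * square_part F \<partial>lborel)"
    by (subst nn_integral_multc) (simp_all add: borel_measurable_indicator)
  also have "\<dots> = (\<integral>\<^sup>+z. \<integral>\<^sup>+M. ?h z * (F (M ** z) * ?w M) \<partial>lborel \<partial>lborel)"
  proof (rule nn_integral_cong_AE, use AE_rotated_embedding[OF le] in eventually_elim)
    fix z :: "('n, 'k) vec_tuple"
    assume "\<exists>Q r. orthogonal_matrix Q \<and> det r \<noteq> 0 \<and> z = rotate_tuple Q (embed_tuple (r :: ('k, 'k) vec_tuple))"
    then obtain Q and r :: "('k, 'k) vec_tuple"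
      where Q: "orthogonal_matrix Q" and r: "det r \<noteq> 0" and z: "z = rotate_tuple Q (embed_tuple r)"
      by blast
    have Fz: "F (M ** z) = F (embed_tuple (M ** r))" for M
      by (simp add: z F_rot Q embed_tuple_mult[OF le] flip: rotate_tuple_mult)
    have hz: "?h z = indicator (cball 0 1) z * ennreal (\<bar>det r\<bar> ^ CARD('n))"
      by (simp add: z gram_density_rotate Q gram_density_embed[OF le] norm_rotate_tuple
          norm_embed_tuple[OF le] indicator_def)
    have "(\<integral>\<^sup>+M. ?h z * (F (M ** z) * ?w M) \<partial>lborel)
        = ?h z * (\<integral>\<^sup>+M. F (embed_tuple (M ** r)) * ?w M \<partial>lborel)"
      unfolding Fz by (rule nn_integral_cmult) measurable
    also have "\<dots> = indicator (cball 0 1) z * square_part F"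
      unfolding hz square_part_translate[OF le F r, symmetric] by (simp add: mult_ac)
    finally show "indicator (cball 0 1) z * square_part F
        = (\<integral>\<^sup>+M. ?h z * (F (M ** z) * ?w M) \<partial>lborel)" by simp
  qed
  also have "\<dots> = (\<integral>\<^sup>+M. \<integral>\<^sup>+z. ?h z * (F (M ** z) * ?w M) \<partial>lborel \<partial>lborel)"
    by (rule lborel_pair.Fubini'[symmetric]) measurable
  also have "\<dots> = (\<integral>\<^sup>+M. \<integral>\<^sup>+x. F x * (?h (cramer_inverse M ** x) * ennreal (1 / \<bar>det M\<bar> ^ CARD('k))) \<partial>lborel \<partial>lborel)"
  proof (rule nn_integral_cong_AE, use AE_det_nonzero in eventually_elim)
    fix M :: "('k, 'k) vec_tuple" assume M: "det M \<noteq> 0"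
    let ?f = "\<lambda>x. ?h (cramer_inverse M ** x) * (F x * ?w M)"
    have "(\<integral>\<^sup>+z. ?h z * (F (M ** z) * ?w M) \<partial>lborel) = (\<integral>\<^sup>+z. ?f (M ** z) \<partial>lborel)"
      by (simp add: matrix_mul_assoc cramer_inverse_left[OF M])
    also have "\<dots> = ennreal (1 / \<bar>det M\<bar> ^ CARD('n)) * (\<integral>\<^sup>+x. ?f x \<partial>lborel)"
      using scales_lborel_matrix_mult_left[OF M, where 'n='n] unfolding scales_lborel_def
      by (auto elim!: allE[where x="?f"])
    also have "\<dots> = (\<integral>\<^sup>+x. ennreal (1 / \<bar>det M\<bar> ^ CARD('n)) * ?f x \<partial>lborel)"
      by (rule nn_integral_cmult[symmetric]) measurable
    also have "\<dots> = (\<integral>\<^sup>+x. F x * (?h (cramer_inverse M ** x) * ennreal (1 / \<bar>det M\<bar> ^ CARD('k))) \<partial>lborel)"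
    proof (rule nn_integral_cong)
      fix x
      have "1 / \<bar>det M\<bar> ^ CARD('n) * \<bar>det M\<bar> ^ (CARD('n) - CARD('k)) = 1 / \<bar>det M\<bar> ^ CARD('k)"
        using le M by (simp add: power_diff)
      then have v: "ennreal (1 / \<bar>det M\<bar> ^ CARD('k)) = ennreal (1 / \<bar>det M\<bar> ^ CARD('n)) * ?w M"
        by (simp add: ennreal_mult[symmetric])
      show "ennreal (1 / \<bar>det M\<bar> ^ CARD('n)) * ?f x
          = F x * (?h (cramer_inverse M ** x) * ennreal (1 / \<bar>det M\<bar> ^ CARD('k)))"
        unfolding v by (simp only: mult_ac)
    qed
    finally show "(\<integral>\<^sup>+z. ?h z * (F (M ** z) * ?w M) \<partial>lborel)
        = (\<integral>\<^sup>+x. F x * (?h (cramer_inverse M ** x) * ennreal (1 / \<bar>det M\<bar> ^ CARD('k))) \<partial>lborel)" .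
  qed
  also have "\<dots> = (\<integral>\<^sup>+x. \<integral>\<^sup>+M. F x * (?h (cramer_inverse M ** x) * ennreal (1 / \<bar>det M\<bar> ^ CARD('k))) \<partial>lborel \<partial>lborel)"
    by (rule lborel_pair.Fubini') measurable
  also have "\<dots> = (\<integral>\<^sup>+x. F x * ?A \<partial>lborel)"
  proof (rule nn_integral_cong_AE, use AE_rotated_embedding[OF le] in eventually_elim)
    fix x :: "('n, 'k) vec_tuple"
    assume "\<exists>Q r. orthogonal_matrix Q \<and> det r \<noteq> 0 \<and> x = rotate_tuple Q (embed_tuple (r :: ('k, 'k) vec_tuple))"
    then obtain Q and r :: "('k, 'k) vec_tuple"
      where Q: "orthogonal_matrix Q" and r: "det r \<noteq> 0" and x: "x = rotate_tuple Q (embed_tuple r)"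
      by blast
    show "(\<integral>\<^sup>+M. F x * (?h (cramer_inverse M ** x) * ennreal (1 / \<bar>det M\<bar> ^ CARD('k))) \<partial>lborel) = F x * ?A"
      unfolding gram_density_translate[OF le r Q, symmetric] x
      by (rule nn_integral_cmult) measurable
  qed
  also have "\<dots> = (\<integral>\<^sup>+x. F x \<partial>lborel) * ?A"
    by (rule nn_integral_multc) measurable
  finally show ?thesis .
qed

text \<open>
  The constant in \<open>nn_integral_invariant_proportional\<close> is positive and finite: the case where \<open>F\<close> is the
  indicator of the unit ball identifies it with the square part of that indicator.
\<close>

theorem nn_integral_orthogonally_invariant:
  assumes le: "CARD('k :: {finite, linorder}) \<le> CARD('n :: {finite, linorder})"
  obtains C :: real where "C > 0"
    "\<And>F :: ('n, 'k) vec_tuple \<Rightarrow> ennreal. F \<in> borel_measurable borel \<Longrightarrow> orthogonally_invariant F \<Longrightarrow>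
      (\<integral>\<^sup>+x. F x \<partial>lborel) = ennreal C * square_part F"
proof -
  let ?B = "cball (0 :: ('n, 'k) vec_tuple) 1"
  let ?b = "cball (0 :: ('k, 'k) vec_tuple) 1"
  have [measurable]: "?B \<in> sets borel" "?b \<in> sets borel" by simp_all
  define A where "A = (\<integral>\<^sup>+M. gram_density (embed_tuple (cramer_inverse M) :: ('n, 'k) vec_tuple)
      * ennreal (1 / \<bar>det (M :: ('k, 'k) vec_tuple)\<bar> ^ CARD('k)) \<partial>lborel)"
  have scaled: "emeasure lborel ?B * square_part F = (\<integral>\<^sup>+x. F x \<partial>lborel) * A"
    if "F \<in> borel_measurable borel" "orthogonally_invariant F" for F :: "('n, 'k) vec_tuple \<Rightarrow> ennreal"
    unfolding A_def using nn_integral_invariant_proportional[OF le that] .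
  have "emeasure lborel (ball (0 :: ('n, 'k) vec_tuple) 1) \<le> emeasure lborel ?B"
    by (intro emeasure_mono) auto
  moreover have "emeasure lborel (ball (0 :: ('n, 'k) vec_tuple) 1) > 0"
    by (simp add: emeasure_ball unit_ball_vol_pos ennreal_zero_less_mult_iff)
  ultimately have B0: "emeasure lborel ?B \<noteq> 0" by auto
  have Btop: "emeasure lborel ?B \<noteq> top"
    using emeasure_compact_finite[of ?B] by simp
  have inv: "orthogonally_invariant (indicator ?B :: ('n, 'k) vec_tuple \<Rightarrow> ennreal)"
    by (simp add: orthogonally_invariant_def indicator_def norm_rotate_tuple)
  have J: "square_part (indicator ?B :: ('n, 'k) vec_tuple \<Rightarrow> ennreal)
      = (\<integral>\<^sup>+y. indicator ?b y * ennreal (\<bar>det y\<bar> ^ (CARD('n) - CARD('k))) \<partial>lborel)"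
    unfolding square_part_def by (simp add: indicator_def norm_embed_tuple[OF le])
  have "emeasure lborel ?B * square_part (indicator ?B) = emeasure lborel ?B * A"
    using scaled[OF borel_measurable_indicator inv] by simp
  then have AJ: "A = square_part (indicator ?B)"
    using B0 Btop by (simp add: ennreal_mult_cancel_left)
  have "A \<noteq> 0"
  proof
    assume "A = 0"
    have [measurable]: "(\<lambda>y :: ('k, 'k) vec_tuple. indicator ?b y * ennreal (\<bar>det y\<bar> ^ (CARD('n) - CARD('k)))) \<in> borel_measurable lborel"
      by measurable
    then have "AE y in lborel. indicator ?b y * ennreal (\<bar>det y\<bar> ^ (CARD('n) - CARD('k))) = 0"
      using \<open>A = 0\<close> unfolding AJ J by (simp only: nn_integral_0_iff_AE)
    then have "AE y in lborel. y \<notin> ?b"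
      using AE_det_nonzero by eventually_elim (auto simp: indicator_def split: if_splits)
    then have "emeasure lborel ?b = 0"
      by (subst (asm) AE_iff_measurable[where N="?b"]) auto
    moreover have "emeasure lborel (ball (0 :: ('k, 'k) vec_tuple) 1) \<le> emeasure lborel ?b"
      by (intro emeasure_mono) auto
    moreover have "emeasure lborel (ball (0 :: ('k, 'k) vec_tuple) 1) > 0"
      by (simp add: emeasure_ball unit_ball_vol_pos ennreal_zero_less_mult_iff)
    ultimately show False by simp
  qed
  moreover have "A \<noteq> top"
  proof -
    have "continuous_on ?b (\<lambda>y. \<bar>det y\<bar> ^ (CARD('n) - CARD('k)))"
      unfolding det_def by (intro continuous_intros)
    then have "integrable lborel (\<lambda>y. indicator ?b y *\<^sub>R (\<bar>det y\<bar> ^ (CARD('n) - CARD('k))))"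
      by (intro borel_integrable_compact) (rule compact_cball)
    then have "(\<integral>\<^sup>+y. ennreal (norm (indicator ?b y *\<^sub>R (\<bar>det y\<bar> ^ (CARD('n) - CARD('k))))) \<partial>lborel) < \<infinity>"
      by (simp add: integrable_iff_bounded)
    also have "(\<integral>\<^sup>+y. ennreal (norm (indicator ?b y *\<^sub>R (\<bar>det y\<bar> ^ (CARD('n) - CARD('k))))) \<partial>lborel) = A"
      unfolding AJ J by (intro nn_integral_cong) (auto simp: indicator_def)
    finally show ?thesis by simp
  qed
  ultimately obtain a where a: "A = ennreal a" "a > 0"
    by (cases A) auto
  obtain b where b: "emeasure lborel ?B = ennreal b" "b > 0"
    using B0 Btop by (cases "emeasure lborel ?B") auto
  show thesis
  proof
    show "b / a > 0" using a b by simp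
    fix F :: "('n, 'k) vec_tuple \<Rightarrow> ennreal"
    assume "F \<in> borel_measurable borel" "orthogonally_invariant F"
    then have "ennreal b * square_part F * ennreal (1 / a) = (\<integral>\<^sup>+x. F x \<partial>lborel) * (ennreal a * ennreal (1 / a))"
      using scaled[of F] unfolding a b by (simp add: mult.assoc)
    moreover have "ennreal b * square_part F * ennreal (1 / a) = ennreal (b / a) * square_part F"
      using a b by (simp add: divide_inverse ennreal_mult mult_ac)
    ultimately show "(\<integral>\<^sup>+x. F x \<partial>lborel) = ennreal (b / a) * square_part F"
      using a by (simp add: ennreal_mult[symmetric])
  qed
qed

section \<open>Lebesgue measurability of invariant sets\<close>

text \<open>
  The union of the orbits of the orthogonal group that meet \<open>S\<close>.
\<close>

definition saturation :: "(real ^ 'n ^ 'k) set \<Rightarrow> (real ^ 'n ^ 'k) set" where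
  "saturation S = (\<lambda>(Q, z). rotate_tuple Q z) ` (Collect orthogonal_matrix \<times> S)"

abbreviation invariant_set :: "(real ^ 'n ^ 'k) set \<Rightarrow> bool" where
  "invariant_set E \<equiv> orthogonally_invariant (\<lambda>x. x \<in> E)"

lemma compact_orthogonal_matrices: "compact (Collect orthogonal_matrix :: (real ^ 'n ^ 'n) set)"
proof -
  have eq: "orthogonal_matrix Q \<longleftrightarrow> (\<forall>i j. (\<Sum>k\<in>UNIV. Q $ k $ i * Q $ k $ j) = (if i = j then 1 else 0))"
    for Q :: "real ^ 'n ^ 'n"
    by (simp add: orthogonal_matrix vec_eq_iff matrix_matrix_mult_def transpose_def mat_def)
  have "closed (Collect orthogonal_matrix :: (real ^ 'n ^ 'n) set)"
    unfolding eq by (intro closed_Collect_all closed_Collect_eq continuous_intros)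
  moreover have "norm Q = sqrt (trace (mat 1 :: real ^ 'n ^ 'n))" if "orthogonal_matrix Q" for Q :: "real ^ 'n ^ 'n"
    using that by (simp add: norm_eq_trace_gram orthogonal_matrix_def)
  then have "bounded (Collect orthogonal_matrix :: (real ^ 'n ^ 'n) set)"
    unfolding bounded_iff by (metis mem_Collect_eq order_refl)
  ultimately show ?thesis
    by (simp add: compact_eq_bounded_closed)
qed

lemma continuous_rotate_tuple: "continuous_on S (\<lambda>(Q, z). rotate_tuple Q z)"
  unfolding rotate_tuple_def matrix_vector_mult_def case_prod_unfold
  by (intro continuous_on_vec_lambda continuous_intros)

lemma fsigma_obtain_compact:
  fixes S :: "'a::euclidean_space set"
  assumes "fsigma S"
  obtains K :: "nat \<Rightarrow> 'a set" where "\<And>i. compact (K i)" "S = (\<Union>i. K i)"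
proof -
  obtain K :: "nat \<Rightarrow> 'a set" where K: "range K \<subseteq> Collect compact" "S = (\<Union>i. K i)"
    using assms fsigma_Union_compact[of S] by metis
  then have "compact (K i)" for i by auto
  then show thesis using that K(2) by blast
qed

text \<open>
  The orthogonal group is compact, so saturations of compact sets are compact. For Borel sets in place of
  countable unions of compact sets one would only obtain an analytic set, which is why inner
  approximation by compact sets is used below.
\<close>

lemma saturation_borel:
  fixes S :: "(real ^ 'n ^ 'k) set"
  assumes "fsigma S"
  shows "saturation S \<in> sets borel"
proof -
  obtain K :: "nat \<Rightarrow> (real ^ 'n ^ 'k) set" where K: "\<And>i. compact (K i)" "S = (\<Union>i. K i)"
    using fsigma_obtain_compact[OF assms] by metis
  have "compact (saturation (K i))" for i
    unfolding saturation_def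
    by (intro compact_continuous_image continuous_rotate_tuple compact_Times compact_orthogonal_matrices K)
  then have "(\<Union>i. saturation (K i)) \<in> sets borel"
    by (intro sets.countable_UN) (auto intro: borel_compact)
  also have "(\<Union>i. saturation (K i)) = saturation S"
    unfolding saturation_def K(2) by blast
  finally show ?thesis .
qed

lemma rotate_tuple_compose: "rotate_tuple P (rotate_tuple Q z) = rotate_tuple (P ** Q) z"
  by (simp add: rotate_tuple_def matrix_vector_mul_assoc)

lemma rotate_tuple_id: "rotate_tuple (mat 1) z = z"
  by (simp add: rotate_tuple_def vec_lambda_eta)

lemma saturation_superset: "S \<subseteq> saturation S"
  unfolding saturation_def
  by (force simp: rotate_tuple_id orthogonal_matrix_id intro!: image_eqI[where x="(mat 1, _)"])

lemma saturation_invariant: "invariant_set (saturation S)"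
proof -
  have sub: "rotate_tuple Q x \<in> saturation S" if "orthogonal_matrix Q" "x \<in> saturation S" for Q x
    using that unfolding saturation_def
    by (force simp: rotate_tuple_compose orthogonal_matrix_mul)
  have "x \<in> saturation S" if Q: "orthogonal_matrix Q" and "rotate_tuple Q x \<in> saturation S" for Q x
  proof -
    have "rotate_tuple (transpose Q) (rotate_tuple Q x) \<in> saturation S"
      by (rule sub) (use that in \<open>simp_all add: orthogonal_matrix_transpose\<close>)
    then show ?thesis
      using Q by (simp add: rotate_tuple_compose orthogonal_matrix_def rotate_tuple_id)
  qed
  with sub show ?thesis unfolding orthogonally_invariant_def by blast
qed

lemma saturation_subset: "invariant_set E \<Longrightarrow> S \<subseteq> E \<Longrightarrow> saturation S \<subseteq> E"
  unfolding saturation_def orthogonally_invariant_def by auto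

text \<open>
  A Lebesgue measurable set contains a countable union of compact sets of full measure. If the set is
  invariant, it also contains the saturation of that union, which is Borel and invariant.
\<close>

lemma lebesgue_invariant_inner_borel:
  assumes "E \<in> sets lebesgue" "invariant_set E"
  obtains B where "B \<in> sets borel" "invariant_set B" "B \<subseteq> E" "E - B \<in> null_sets lebesgue"
proof -
  obtain S T where ST: "fsigma S" "T \<in> null_sets lebesgue" "S \<union> T = E"
    using lebesgue_set_almost_fsigma[OF assms(1)] by metis
  have "E - saturation S \<subseteq> T" using ST saturation_superset by blast
  then show thesis
    using that[of "saturation S"] ST saturation_borel saturation_invariant saturation_subset[OF assms(2)]
    by (metis completion.complete2 Un_upper1)
qed

context
  assumes le: "CARD('k :: {finite, linorder}) \<le> CARD('n :: {finite, linorder})"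
begin

text \<open>
  The same argument, with compact sets of square matrices that are embedded before they are saturated.
\<close>

lemma invariant_inner_borel_of_square_part:
  fixes E :: "('n, 'k) vec_tuple set"
  assumes "embed_tuple -` E \<in> sets (lebesgue :: ('k, 'k) vec_tuple measure)" "invariant_set E"
  obtains B where "B \<in> sets borel" "invariant_set B" "B \<subseteq> E"
    "embed_tuple -` (E - B) \<in> null_sets (lebesgue :: ('k, 'k) vec_tuple measure)"
proof -
  let ?e = "embed_tuple :: ('k, 'k) vec_tuple \<Rightarrow> ('n, 'k) vec_tuple"
  obtain S T where ST: "fsigma S" "T \<in> null_sets lebesgue" "S \<union> T = ?e -` E"
    using lebesgue_set_almost_fsigma[OF assms(1)] by metis
  obtain K :: "nat \<Rightarrow> ('k, 'k) vec_tuple set" where K: "\<And>i. compact (K i)" "S = (\<Union>i. K i)"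
    using fsigma_obtain_compact[OF ST(1)] by metis
  have "compact (?e ` K i)" for i
    by (intro compact_continuous_image continuous_on_subset[OF continuous_embed_tuple[OF le]] K) simp
  then have "fsigma (?e ` S)"
    unfolding fsigma_Union_compact K(2) by (intro exI[of _ "\<lambda>i. ?e ` K i"]) (auto simp: image_UN)
  then have "saturation (?e ` S) \<in> sets borel" by (rule saturation_borel)
  moreover have "saturation (?e ` S) \<subseteq> E"
    using ST(3) by (intro saturation_subset[OF assms(2)]) blast
  moreover have "?e -` (E - saturation (?e ` S)) \<subseteq> T"
    using ST(3) saturation_superset[of "?e ` S"] by blast
  then have "?e -` (E - saturation (?e ` S)) \<in> null_sets lebesgue"
    using ST(2) by (rule completion.complete2)
  ultimately show thesis
    using that saturation_invariant by blast
qed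

lemma square_part_null_iff:
  fixes F :: "('n, 'k) vec_tuple \<Rightarrow> ennreal"
  assumes "F \<in> borel_measurable borel"
  shows "square_part F = 0 \<longleftrightarrow> (AE y in lborel. F (embed_tuple (y :: ('k, 'k) vec_tuple)) = 0)"
proof -
  note [measurable] = borel_measurable_embed_tuple[OF le] assms
  have "square_part F = 0 \<longleftrightarrow>
      (AE y in lborel. F (embed_tuple (y :: ('k, 'k) vec_tuple)) * ennreal (\<bar>det y\<bar> ^ (CARD('n) - CARD('k))) = 0)"
    unfolding square_part_def by (rule nn_integral_0_iff_AE) measurable
  also have "\<dots> \<longleftrightarrow> (AE y in lborel. F (embed_tuple (y :: ('k, 'k) vec_tuple)) = 0)"
    by (rule eventually_cong) (use AE_det_nonzero in \<open>eventually_elim, auto\<close>)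
  finally show ?thesis .
qed

lemma embed_vimage_borel:
  "B \<in> sets borel \<Longrightarrow> embed_tuple -` (B :: ('n, 'k) vec_tuple set) \<in> sets (borel :: ('k, 'k) vec_tuple measure)"
  using measurable_sets[OF borel_measurable_continuous_onI[OF continuous_embed_tuple[OF le]], of B] by simp

text \<open>
  The constant is positive and the density vanishes only on a null set.
\<close>

lemma invariant_null_iff:
  fixes B :: "('n, 'k) vec_tuple set"
  assumes B [measurable]: "B \<in> sets borel" and inv: "invariant_set B"
  shows "B \<in> null_sets lborel \<longleftrightarrow> embed_tuple -` B \<in> null_sets (lborel :: ('k, 'k) vec_tuple measure)"
proof -
  have inv': "orthogonally_invariant (indicator B :: _ \<Rightarrow> ennreal)"
    using inv by (simp add: orthogonally_invariant_def indicator_def)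
  obtain C :: real where C: "C > 0" "emeasure lborel B = ennreal C * square_part (indicator B)"
    using nn_integral_orthogonally_invariant[OF le] inv' by (metis B borel_measurable_indicator nn_integral_indicator sets_lborel)
  have "B \<in> null_sets lborel \<longleftrightarrow> square_part (indicator B) = 0"
    using C by (simp add: null_sets_def)
  also have "\<dots> \<longleftrightarrow> (AE y in lborel. (indicator B (embed_tuple (y :: ('k, 'k) vec_tuple)) :: ennreal) = 0)"
    by (rule square_part_null_iff) simp
  also have "\<dots> \<longleftrightarrow> (AE y in lborel. (y :: ('k, 'k) vec_tuple) \<notin> embed_tuple -` B)"
    by (simp add: indicator_def)
  also have "\<dots> \<longleftrightarrow> embed_tuple -` B \<in> null_sets (lborel :: ('k, 'k) vec_tuple measure)"
    using embed_vimage_borel[OF B] by (subst AE_iff_null_sets) auto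
  finally show ?thesis .
qed

text \<open>
  Inner approximation of \<open>E\<close> and of its complement leaves out an invariant Borel set, which is null in one of
  the two spaces by hypothesis and then in the other one by \<open>invariant_null_iff\<close>. This is what carries
  Lebesgue measurability from one space to the other.
\<close>

lemma invariant_sandwich:
  fixes E :: "('n, 'k) vec_tuple set"
  assumes "E \<in> sets lebesgue \<or> embed_tuple -` E \<in> sets (lebesgue :: ('k, 'k) vec_tuple measure)"
    and inv: "invariant_set E"
  obtains B where "B \<in> sets borel" "invariant_set B" "AE x in lebesgue. x \<in> B \<longleftrightarrow> x \<in> E"
    "AE y in lebesgue. y \<in> embed_tuple -` B \<longleftrightarrow> (y :: ('k, 'k) vec_tuple) \<in> embed_tuple -` E"
proof -
  let ?e = "embed_tuple :: ('k, 'k) vec_tuple \<Rightarrow> ('n, 'k) vec_tuple"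
  have invC: "invariant_set (- E)"
    using inv by (simp add: orthogonally_invariant_def)
  obtain B B' where B: "B \<in> sets borel" "invariant_set B" "B \<subseteq> E"
    and B': "B' \<in> sets borel" "invariant_set B'" "B' \<subseteq> - E"
    and null: "(E - B) \<union> (- E - B') \<in> null_sets lebesgue
      \<or> ?e -` ((E - B) \<union> (- E - B')) \<in> null_sets lebesgue"
    using assms(1)
  proof
    assume E: "E \<in> sets lebesgue"
    have "- E \<in> sets lebesgue" using E by (simp add: Compl_in_sets_lebesgue)
    obtain B where B: "B \<in> sets borel" "invariant_set B" "B \<subseteq> E" "E - B \<in> null_sets lebesgue"
      using lebesgue_invariant_inner_borel[OF E inv] .
    obtain B' where B': "B' \<in> sets borel" "invariant_set B'" "B' \<subseteq> - E" "- E - B' \<in> null_sets lebesgue"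
      using lebesgue_invariant_inner_borel[OF \<open>- E \<in> sets lebesgue\<close> invC] .
    show thesis
      by (rule that[OF B(1-3) B'(1-3)]) (use B(4) B'(4) in auto)
  next
    assume E: "?e -` E \<in> sets lebesgue"
    have eC: "?e -` (- E) \<in> sets lebesgue"
      using E by (simp add: Compl_in_sets_lebesgue vimage_Compl)
    obtain B where B: "B \<in> sets borel" "invariant_set B" "B \<subseteq> E" "?e -` (E - B) \<in> null_sets lebesgue"
      using invariant_inner_borel_of_square_part[OF E inv] .
    obtain B' where B': "B' \<in> sets borel" "invariant_set B'" "B' \<subseteq> - E"
        "?e -` (- E - B') \<in> null_sets lebesgue"
      using invariant_inner_borel_of_square_part[OF eC invC] .
    have "?e -` ((E - B) \<union> (- E - B')) \<in> null_sets lebesgue"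
      unfolding vimage_Un using B(4) B'(4) by (rule null_sets.Un)
    then show thesis
      using that[OF B(1-3) B'(1-3)] by blast
  qed
  let ?N = "- (B \<union> B')"
  have N: "?N = (E - B) \<union> (- E - B')" using B(3) B'(3) by blast
  have Nb: "?N \<in> sets borel" using B B' by auto
  have invN: "invariant_set ?N" using B(2) B'(2) by (simp add: orthogonally_invariant_def)
  have nulls: "?N \<in> null_sets lborel \<and> ?e -` ?N \<in> null_sets lborel"
    using null unfolding N[symmetric] invariant_null_iff[OF Nb invN, symmetric]
    using Nb embed_vimage_borel[OF Nb] invariant_null_iff[OF Nb invN]
    by (auto simp: null_sets_completion_iff)
  have AE: "AE x in lebesgue. x \<notin> ?N" "AE y in lebesgue. y \<notin> ?e -` ?N"
    by (rule AE_completion[OF AE_not_in[OF conjunct1[OF nulls]]])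
      (rule AE_completion[OF AE_not_in[OF conjunct2[OF nulls]]])
  show thesis
  proof
    show "AE x in lebesgue. x \<in> B \<longleftrightarrow> x \<in> E"
      using AE(1) by eventually_elim (use B(3) B'(3) in blast)
    show "AE y in lebesgue. y \<in> ?e -` B \<longleftrightarrow> y \<in> ?e -` E"
      using AE(2) by eventually_elim (use B(3) B'(3) in blast)
  qed (use B in auto)
qed

lemma invariant_lebesgue_iff:
  fixes E :: "('n, 'k) vec_tuple set"
  assumes inv: "invariant_set E"
  shows "E \<in> sets lebesgue \<longleftrightarrow> embed_tuple -` E \<in> sets (lebesgue :: ('k, 'k) vec_tuple measure)"
    (is "?L \<longleftrightarrow> ?R")
proof -
  have "?L \<and> ?R" if either: "?L \<or> ?R"
  proof -
    obtain B where B: "B \<in> sets borel" "invariant_set B" "AE x in lebesgue. x \<in> B \<longleftrightarrow> x \<in> E"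
      "AE y in lebesgue. y \<in> embed_tuple -` B \<longleftrightarrow> (y :: ('k, 'k) vec_tuple) \<in> embed_tuple -` E"
      using invariant_sandwich[OF either inv] .
    then show ?thesis
      using completion.in_sets_AE[OF B(3)] completion.in_sets_AE[OF B(4)] embed_vimage_borel[OF B(1)]
      by simp
  qed
  then show ?thesis by blast
qed

lemma emeasure_lebesgue_invariant:
  obtains C :: real where "C > 0"
    "\<And>E :: ('n, 'k) vec_tuple set. E \<in> sets lebesgue \<Longrightarrow> invariant_set E \<Longrightarrow>
      emeasure lebesgue E = emeasure
        (density lebesgue (\<lambda>y :: ('k, 'k) vec_tuple. ennreal (C * \<bar>det y\<bar> ^ (CARD('n) - CARD('k)))))
        (embed_tuple -` E)"
proof -
  obtain C :: real where C: "C > 0"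
    "\<And>F :: ('n, 'k) vec_tuple \<Rightarrow> ennreal. F \<in> borel_measurable borel \<Longrightarrow> orthogonally_invariant F \<Longrightarrow>
      (\<integral>\<^sup>+x. F x \<partial>lborel) = ennreal C * square_part F"
    using nn_integral_orthogonally_invariant[OF le] by metis
  let ?w = "\<lambda>y :: ('k, 'k) vec_tuple. \<bar>det y\<bar> ^ (CARD('n) - CARD('k))"
  let ?e = "embed_tuple :: ('k, 'k) vec_tuple \<Rightarrow> ('n, 'k) vec_tuple"
  have w [measurable]: "?w \<in> borel_measurable borel" by measurable
  show thesis
  proof
    fix E :: "('n, 'k) vec_tuple set"
    assume E: "E \<in> sets lebesgue" and inv: "invariant_set E"
    then have eE: "?e -` E \<in> sets lebesgue"
      using invariant_lebesgue_iff by blast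
    obtain B where B: "B \<in> sets borel" "invariant_set B" "AE x in lebesgue. x \<in> B \<longleftrightarrow> x \<in> E"
      "AE y in lebesgue. y \<in> ?e -` B \<longleftrightarrow> y \<in> ?e -` E"
      using invariant_sandwich[OF disjI1[OF E] inv] .
    note [measurable] = B(1) embed_vimage_borel[OF B(1)]
    have "emeasure lebesgue E = emeasure lebesgue B"
      by (rule emeasure_eq_AE) (use B E in auto)
    also have "\<dots> = (\<integral>\<^sup>+x. indicator B x \<partial>lborel)"
      using B(1) by simp
    also have "\<dots> = ennreal C * square_part (indicator B)"
      using B(1,2) by (intro C) (auto simp: orthogonally_invariant_def indicator_def)
    also have "\<dots> = (\<integral>\<^sup>+y. ennreal C * (indicator (?e -` B) y * ennreal (?w y)) \<partial>lborel)"
    proof -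
      have "square_part (indicator B) = (\<integral>\<^sup>+y. indicator (?e -` B) y * ennreal (?w y) \<partial>lborel)"
        unfolding square_part_def by (simp add: indicator_def)
      then show ?thesis
        by (simp add: nn_integral_cmult)
    qed
    also have "\<dots> = (\<integral>\<^sup>+y. ennreal (C * ?w y) * indicator (?e -` B) y \<partial>lebesgue)"
      using C(1) by (simp add: nn_integral_completion ennreal_mult mult_ac)
    also have "\<dots> = (\<integral>\<^sup>+y. ennreal (C * ?w y) * indicator (?e -` E) y \<partial>lebesgue)"
      by (rule nn_integral_cong_AE) (use B(4) in \<open>eventually_elim, auto simp: indicator_def\<close>)
    also have "\<dots> = emeasure (density lebesgue (\<lambda>y. ennreal (C * ?w y))) (?e -` E)"
      by (rule emeasure_density[symmetric]) (auto intro!: measurable_completion eE)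
    finally show "emeasure lebesgue E = emeasure (density lebesgue (\<lambda>y. ennreal (C * ?w y))) (?e -` E)" .
  qed (fact C(1))
qed

lemma symmetric_lebesgue_measurable_iff:
  fixes \<phi> :: "('n, 'k) vec_tuple \<Rightarrow> real"
  assumes "orthogonally_invariant \<phi>"
  shows "\<phi> \<in> borel_measurable lebesgue \<longleftrightarrow>
    (\<lambda>y :: ('k, 'k) vec_tuple. \<phi> (embed_tuple y)) \<in> borel_measurable lebesgue"
proof -
  have "\<phi> -` A \<in> sets lebesgue \<longleftrightarrow>
      (\<lambda>y :: ('k, 'k) vec_tuple. \<phi> (embed_tuple y)) -` A \<in> sets lebesgue" for A
    using invariant_lebesgue_iff[of "\<phi> -` A"] assms
    by (simp add: orthogonally_invariant_def vimage_def)
  then show ?thesis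
    by (simp add: measurable_def)
qed

end

section \<open>The integral formula\<close>

lemma orthogonally_symmetric_iff: "orthogonally_symmetric \<phi> \<longleftrightarrow> orthogonally_invariant \<phi>"
  by (simp add: orthogonally_symmetric_def orthogonally_invariant_def rotate_tuple_def)

lemma det_column_matrix: "det (column_matrix x) = det (x :: real ^ 'k ^ 'k)"
proof -
  have "column_matrix x = transpose x"
    by (simp add: column_matrix_def transpose_def)
  then show ?thesis by (simp add: det_transpose)
qed

text \<open>
  Let \<open>\<mu>\<close> be the weighted measure on square matrices. Preimages of Borel sets under \<open>\<phi>\<close> are invariant, so
  \<open>\<phi>\<close> and \<open>\<phi>\<close> composed with the embedding have the same distribution on the real line, under Lebesgue
  measure and under \<open>\<mu>\<close> respectively. Integrability and the integral depend on the distribution only. If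
  \<open>\<phi>\<close> is not measurable, neither is the integrand on the right, since its weight is nonzero almost
  everywhere; then both integrals are \<open>0\<close> by convention.
\<close>

theorem theorem2p1:
  assumes "CARD('k :: {finite, linorder}) \<le> CARD('n :: {finite, linorder})"
  shows "\<exists>C :: real. \<forall>\<phi> :: ('n, 'k) vec_tuple \<Rightarrow> real. orthogonally_symmetric \<phi> \<longrightarrow>
    (integrable lebesgue \<phi> \<longleftrightarrow>
     integrable lebesgue (\<lambda>x :: ('k, 'k) vec_tuple. \<phi> (\<chi> j. natural_embedding (x $ j)) *
       (C * \<bar>det (column_matrix x)\<bar> ^ (CARD('n) - CARD('k))))) \<and>
    (LINT x | lebesgue. \<phi> x) =
    (LINT x :: ('k, 'k) vec_tuple | lebesgue. \<phi> (\<chi> j. natural_embedding (x $ j)) *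
       (C * \<bar>det (column_matrix x)\<bar> ^ (CARD('n) - CARD('k))))"
proof -
  obtain C :: real where C: "C > 0"
    "\<And>E :: ('n, 'k) vec_tuple set. E \<in> sets lebesgue \<Longrightarrow> invariant_set E \<Longrightarrow>
      emeasure lebesgue E = emeasure
        (density lebesgue (\<lambda>y :: ('k, 'k) vec_tuple. ennreal (C * \<bar>det y\<bar> ^ (CARD('n) - CARD('k)))))
        (embed_tuple -` E)"
    using emeasure_lebesgue_invariant[OF assms] by metis
  let ?w = "\<lambda>y :: ('k, 'k) vec_tuple. C * \<bar>det y\<bar> ^ (CARD('n) - CARD('k))"
  let ?e = "embed_tuple :: ('k, 'k) vec_tuple \<Rightarrow> ('n, 'k) vec_tuple"
  let ?D = "density lebesgue (\<lambda>y. ennreal (?w y))"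
  have "?w \<in> borel_measurable borel" by measurable
  then have w [measurable]: "?w \<in> borel_measurable lebesgue"
    by (intro measurable_completion) simp
  have w_nonneg: "AE y in lebesgue. 0 \<le> ?w y" using C(1) by simp
  have w_nonzero: "AE y in lebesgue. ?w y \<noteq> 0"
  proof -
    have "AE y in lebesgue. det (y :: ('k, 'k) vec_tuple) \<noteq> 0"
      by (rule AE_completion) (rule AE_det_nonzero)
    then show ?thesis by eventually_elim (use C(1) in simp)
  qed
  have main: "(integrable lebesgue \<phi> \<longleftrightarrow> integrable lebesgue (\<lambda>y. \<phi> (?e y) * ?w y)) \<and>
      (LINT x | lebesgue. \<phi> x) = (LINT y | lebesgue. \<phi> (?e y) * ?w y)"
    if inv: "orthogonally_invariant \<phi>" for \<phi> :: "('n, 'k) vec_tuple \<Rightarrow> real"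
  proof (cases "\<phi> \<in> borel_measurable lebesgue")
    case True
    then have \<phi>e: "(\<lambda>y. \<phi> (?e y)) \<in> borel_measurable lebesgue"
      using symmetric_lebesgue_measurable_iff[OF assms inv] by simp
    then have \<phi>eD: "(\<lambda>y. \<phi> (?e y)) \<in> borel_measurable ?D" by simp
    have distr: "distr lebesgue borel \<phi> = distr ?D borel (\<lambda>y. \<phi> (?e y))"
    proof (rule measure_eqI)
      fix A assume "A \<in> sets (distr lebesgue borel \<phi>)"
      then have A: "A \<in> sets borel" by simp
      then have "\<phi> -` A \<in> sets lebesgue"
        using measurable_sets[OF True A] by simp
      moreover have "invariant_set (\<phi> -` A)"
        using inv by (simp add: orthogonally_invariant_def)
      ultimately have "emeasure lebesgue (\<phi> -` A) = emeasure ?D (?e -` (\<phi> -` A))"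
        by (rule C)
      then show "emeasure (distr lebesgue borel \<phi>) A = emeasure (distr ?D borel (\<lambda>y. \<phi> (?e y))) A"
        using A True \<phi>eD by (simp add: emeasure_distr vimage_def)
    qed simp
    have "integrable lebesgue \<phi> \<longleftrightarrow> integrable (distr lebesgue borel \<phi>) (\<lambda>t. t)"
      using True by (simp add: integrable_distr_eq)
    also have "\<dots> \<longleftrightarrow> integrable ?D (\<lambda>y. \<phi> (?e y))"
      unfolding distr using \<phi>eD by (simp add: integrable_distr_eq)
    also have "\<dots> \<longleftrightarrow> integrable lebesgue (\<lambda>y. ?w y *\<^sub>R \<phi> (?e y))"
      by (rule integrable_density[OF \<phi>e w w_nonneg])
    finally have 1: "integrable lebesgue \<phi> \<longleftrightarrow> integrable lebesgue (\<lambda>y. \<phi> (?e y) * ?w y)"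
      by (simp add: mult.commute)
    have "(LINT x | lebesgue. \<phi> x) = (LINT t | distr lebesgue borel \<phi>. t)"
      using True by (simp add: integral_distr)
    also have "\<dots> = (LINT y | ?D. \<phi> (?e y))"
      unfolding distr using \<phi>eD by (simp add: integral_distr)
    also have "\<dots> = (LINT y | lebesgue. ?w y *\<^sub>R \<phi> (?e y))"
      by (rule integral_density[OF \<phi>e w w_nonneg])
    finally have 2: "(LINT x | lebesgue. \<phi> x) = (LINT y | lebesgue. \<phi> (?e y) * ?w y)"
      by (simp add: mult.commute)
    from 1 2 show ?thesis by blast
  next
    case False
    then have "\<not> integrable lebesgue \<phi>" by auto
    moreover have "\<not> integrable lebesgue (\<lambda>y. \<phi> (?e y) * ?w y)"
    proof
      assume "integrable lebesgue (\<lambda>y. \<phi> (?e y) * ?w y)"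
      then have [measurable]: "(\<lambda>y. \<phi> (?e y) * ?w y) \<in> borel_measurable lebesgue"
        by (rule borel_measurable_integrable)
      have quot: "(\<lambda>y. \<phi> (?e y) * ?w y / ?w y) \<in> borel_measurable lebesgue"
        by measurable
      have "(\<lambda>y. \<phi> (?e y)) -` A \<in> sets lebesgue" if A: "A \<in> sets borel" for A
      proof (rule completion.in_sets_AE)
        show "(\<lambda>y. \<phi> (?e y) * ?w y / ?w y) -` A \<in> sets lebesgue"
          using measurable_sets[OF quot A] by simp
        show "AE y in lebesgue. (y \<in> (\<lambda>y. \<phi> (?e y) * ?w y / ?w y) -` A) = (y \<in> (\<lambda>y. \<phi> (?e y)) -` A)"
          using w_nonzero
        proof eventually_elim
          case (elim y)
          then have "\<phi> (?e y) * ?w y / ?w y = \<phi> (?e y)"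
            by (rule nonzero_mult_div_cancel_right)
          then show ?case by (simp only: vimage_eq)
        qed
      qed simp
      then have "(\<lambda>y. \<phi> (?e y)) \<in> borel_measurable lebesgue"
        by (simp add: measurable_def)
      with False show False
        using symmetric_lebesgue_measurable_iff[OF assms inv] by simp
    qed
    ultimately show ?thesis
      by (simp add: not_integrable_integral_eq)
  qed
  show ?thesis
    using main unfolding orthogonally_symmetric_iff det_column_matrix embed_tuple_def by blast
qed

end
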